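(* Every isothermic congruence $(c,c_F)$ defines a unique S-isothermic net $(h_\circ,h_\bullet,h_F)$ such that $h_\circ(w)=c(w)$ for all white vertices $w$. Vice versa, every S-isothermic net $(h_\circ,h_\bullet,h_F)$ defines two isothermic congruences $(c,c_F)$ such that $c(w)=h_\circ(w)$ for all white vertices $w$.
   Context: $\mathbb{Z}^2$ is the vertex set of the square lattice graph, $F(\mathbb{Z}^2)$ its set of unit square faces. Black vertices $\mathbb{Z}^2_\bullet$: $z_1+z_2$ even; white vertices $\mathbb{Z}^2_\circ$: $z_1+z_2$ odd. A face has the form $f=(w,b,w',b')$ with $w,w'$ white and $b,b'$ black. Lorentz space $\mathbf{L}^3$ is $\mathbb{R}^3$ with $\langle x,y\rangle = x_1y_1+x_2y_2-x_3y_3$. A plane is spacelike if $\langle\cdot,\cdot\rangle$ restricted to its direction space is positive definite. A sphere with center $m$ and squared radius $\rho\in\mathbb{R}$ is $\{x:\langle x-m,x-m\rangle=\rho\}$; it is a timelike sphere if $\rho>0$ and a null-sphere if $\rho=0$. Circles are the non-empty planar sections of spheres; a spacelike circle is a circle contained in a spacelike plane. An oriented timelike sphere is a timelike sphere with a choice of orientation, outwards or inwards, which induces an orientation of all its tangent planes; null-spheres carry no orientation. Two oriented timelike spheres are in oriented contact if they share a point and have the same oriented tangent plane at that point. A circle intersects a timelike sphere orthogonally in a point $T$ if $T$ lies on both and the tangent line of the circle at $T$ is orthogonal to the tangent plane of the sphere at $T$. An isotropic line is $L=\{q+td : t\in\mathbb{R}\}$ with $d\ne0$, $\langle d,d\rangle=0$;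 it lies in the unique isotropic plane $H_L=\{x:\langle x-q,d\rangle=0\}$. An orientation of $L$ is the choice of one of the two components $\Omega$ of $H_L\setminus L$. A null-sphere is in contact with an oriented isotropic line iff its center lies on $L$. An oriented timelike sphere with center $m$ is in oriented contact with $(L,\Omega)$ iff it contains $L$ (which forces $m\in H_L\setminus L$) and $m\notin\Omega$ if the sphere is oriented outwards, $m\in\Omega$ if it is oriented inwards. A contact congruence is a pair of maps $c$ (from $\mathbb{Z}^2$ to oriented timelike spheres and null-spheres) and $c_F$ (from $F(\mathbb{Z}^2)$ to oriented isotropic lines) such that $c(v)$ is in oriented contact with $c_F(f)$ whenever $v$ and $f$ are incident. It is a null congruence if $c(b)$ is a null-sphere for every black $b$ and $c(w)$ is an oriented timelike sphere for every white $w$. An isothermic congruence is a null congruence such that the centers of the white spheres form a spacelike conjugate net, that is, for each black vertex $b$ the centers of the four spheres $c(w)$, $w$ adjacent to $b$, are contained in a spacelike plane. A (spacelike Lorentz) S-isothermic net is a collection of maps $h_\circ$ from $\mathbb{Z}^2_\circ$ to oriented timelike spheres, $h_\bullet$ from $\mathbb{Z}^2_\bullet$ to spacelike circles, and $h_F:F(\mathbb{Z}^2)\to\mathbf{L}^3$, such that for all faces $f=(w,b,w',b')$ the two spheres $h_\circ(w)$, $h_\circ(w')$ are in oriented contact and the two circles $h_\bullet(b)$, $h_\bullet(b')$ intersect the two spheres orthogonally in the point $h_F(f)$.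
   Formalization: Genericity is added: the two white spheres of each face are distinct; for congruence to net, the four centers around each black vertex are not collinear; for net to congruences, contact points of adjacent faces are distinct. Without it the claim fails. *)

theory Defs
  imports "HOL-Analysis.Analysis"
begin

type_synonym vertex = "int \<times> int"

definition black :: "vertex set" where
  "black = {(i, j). even (i + j)}"

definition white :: "vertex set" where
  "white = {(i, j). odd (i + j)}"

definition neighbours :: "vertex \<Rightarrow> vertex set" where
  "neighbours = (\<lambda>(i, j). {(i + 1, j), (i, j + 1), (i - 1, j), (i, j - 1)})"

(* A unit square face is represented by its lower left corner, so that maps on the set of
   faces are maps on int * int, and two faces share an edge iff their corners are neighbours. *)
type_synonym face = "int \<times> int"

definition face_vertices :: "face \<Rightarrow> vertex set" where
  "face_vertices = (\<lambda>(i, j). {(i, j), (i + 1, j), (i + 1, j + 1), (i, j + 1)})"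


type_synonym point = "real ^ 3"

definition lor :: "point \<Rightarrow> point \<Rightarrow> real" where
  "lor x y = x $ 1 * y $ 1 + x $ 2 * y $ 2 - x $ 3 * y $ 3"

definition plane :: "point set \<Rightarrow> bool" where
  "plane E \<longleftrightarrow> affine E \<and> aff_dim E = 2"

definition spacelike_plane :: "point set \<Rightarrow> bool" where
  "spacelike_plane E \<longleftrightarrow>
     plane E \<and> (\<forall>x\<in>E. \<forall>y\<in>E. x \<noteq> y \<longrightarrow> lor (x - y) (x - y) > 0)"

definition lsphere :: "point \<Rightarrow> real \<Rightarrow> point set" where
  "lsphere m \<rho> = {x. lor (x - m) (x - m) = \<rho>}"

(* Tangent plane at p of the sphere with center m through p (for p = m, the singular point of
   a null-sphere, this is the whole space). *)
definition tangent_plane :: "point \<Rightarrow> point \<Rightarrow> point set" where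
  "tangent_plane m p = {x. lor (x - p) (p - m) = 0}"

definition circle :: "point set \<Rightarrow> bool" where
  "circle C \<longleftrightarrow> C \<noteq> {} \<and> (\<exists>E m \<rho>. plane E \<and> C = E \<inter> lsphere m \<rho>)"

definition spacelike_circle :: "point set \<Rightarrow> bool" where
  "spacelike_circle C \<longleftrightarrow> circle C \<and> (\<exists>E. spacelike_plane E \<and> C \<subseteq> E)"

(* l is the tangent line at p of the spacelike circle C. Cutting the plane of C with the tangent
   plane of a sphere through C gives a line, except when C is a single point; such a circle has
   no tangent line. *)
definition circle_tangent_line :: "point set \<Rightarrow> point \<Rightarrow> point set \<Rightarrow> bool" where
  "circle_tangent_line C p l \<longleftrightarrow>
     (\<exists>E m \<rho>. spacelike_plane E \<and> C = E \<inter> lsphere m \<rho> \<and> p \<in> C \<and>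
        l = E \<inter> tangent_plane m p \<and> aff_dim l = 1)"


datatype orientation = Outwards | Inwards

(* Values of congruences: null-spheres, given by their center, and oriented timelike spheres,
   given by center, squared radius (required to be positive in timelike below) and orientation.
   The point set of a timelike sphere determines its center and squared radius. *)
datatype osphere =
    Null (center: point)
  | Timelike (center: point) (sqradius: real) (orient: orientation)

definition null_sphere :: "osphere \<Rightarrow> bool" where
  "null_sphere s \<longleftrightarrow> (\<exists>m. s = Null m)"

definition timelike :: "osphere \<Rightarrow> bool" where
  "timelike s \<longleftrightarrow> (\<exists>m \<rho> e. s = Timelike m \<rho> e \<and> \<rho> > 0)"

fun points :: "osphere \<Rightarrow> point set" where
  "points (Null m) = lsphere m 0"
| "points (Timelike m \<rho> e) = lsphere m \<rho>"

(* The tangent plane at p together with the open half-space into which the sphere's orientation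
   points; the outward normal at p is p - m. *)
definition oriented_tangent_plane :: "osphere \<Rightarrow> point \<Rightarrow> point set \<times> point set" where
  "oriented_tangent_plane s p =
     (tangent_plane (center s) p,
      case orient s of
        Outwards \<Rightarrow> {x. lor (x - p) (p - center s) > 0}
      | Inwards \<Rightarrow> {x. lor (x - p) (p - center s) < 0})"

definition oriented_contact :: "osphere \<Rightarrow> osphere \<Rightarrow> bool" where
  "oriented_contact s s' \<longleftrightarrow>
     timelike s \<and> timelike s' \<and>
     (\<exists>p. p \<in> points s \<and> p \<in> points s' \<and>
          oriented_tangent_plane s p = oriented_tangent_plane s' p)"

definition meets_orthogonally :: "point set \<Rightarrow> osphere \<Rightarrow> point \<Rightarrow> bool" where
  "meets_orthogonally C s p \<longleftrightarrow>
     p \<in> C \<and> p \<in> points s \<and>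
     (\<exists>l. circle_tangent_line C p l \<and>
        (\<forall>x\<in>l. \<forall>y\<in>tangent_plane (center s) p. lor (x - p) (y - p) = 0))"


type_synonym oline = "point set \<times> point set"

definition oriented_isotropic_line :: "oline \<Rightarrow> bool" where
  "oriented_isotropic_line = (\<lambda>(L, \<Omega>).
     \<exists>q d. d \<noteq> 0 \<and> lor d d = 0 \<and> L = {q + t *\<^sub>R d | t. True} \<and>
       \<Omega> \<in> components ({x. lor (x - q) d = 0} - L))"

fun contact_line :: "osphere \<Rightarrow> oline \<Rightarrow> bool" where
  "contact_line (Null m) (L, \<Omega>) \<longleftrightarrow> m \<in> L"
| "contact_line (Timelike m \<rho> e) (L, \<Omega>) \<longleftrightarrow>
     L \<subseteq> lsphere m \<rho> \<and> (case e of Outwards \<Rightarrow> m \<notin> \<Omega> | Inwards \<Rightarrow> m \<in> \<Omega>)"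


definition contact_congruence :: "(vertex \<Rightarrow> osphere) \<Rightarrow> (face \<Rightarrow> oline) \<Rightarrow> bool" where
  "contact_congruence c cF \<longleftrightarrow>
     (\<forall>v. null_sphere (c v) \<or> timelike (c v)) \<and>
     (\<forall>f. oriented_isotropic_line (cF f)) \<and>
     (\<forall>f. \<forall>v\<in>face_vertices f. contact_line (c v) (cF f))"

definition null_congruence :: "(vertex \<Rightarrow> osphere) \<Rightarrow> (face \<Rightarrow> oline) \<Rightarrow> bool" where
  "null_congruence c cF \<longleftrightarrow>
     contact_congruence c cF \<and>
     (\<forall>b\<in>black. null_sphere (c b)) \<and> (\<forall>w\<in>white. timelike (c w))"

definition isothermic_congruence :: "(vertex \<Rightarrow> osphere) \<Rightarrow> (face \<Rightarrow> oline) \<Rightarrow> bool" where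
  "isothermic_congruence c cF \<longleftrightarrow>
     null_congruence c cF \<and>
     (\<forall>b\<in>black. \<exists>E. spacelike_plane E \<and> (\<forall>w\<in>neighbours b. center (c w) \<in> E))"

(* Maps defined only on the white (black) vertices are functions in extensional white
   (extensional black), so that equality of functions is equality on the actual domain. *)
definition S_isothermic_net ::
  "(vertex \<Rightarrow> osphere) \<Rightarrow> (vertex \<Rightarrow> point set) \<Rightarrow> (face \<Rightarrow> point) \<Rightarrow> bool" where
  "S_isothermic_net hw hb hF \<longleftrightarrow>
     hw \<in> extensional white \<and> (\<forall>w\<in>white. timelike (hw w)) \<and>
     hb \<in> extensional black \<and> (\<forall>b\<in>black. spacelike_circle (hb b)) \<and>
     (\<forall>f.
       (\<forall>w\<in>face_vertices f \<inter> white. \<forall>w'\<in>face_vertices f \<inter> white.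
          w \<noteq> w' \<longrightarrow> oriented_contact (hw w) (hw w')) \<and>
       (\<forall>b\<in>face_vertices f \<inter> black. \<forall>w\<in>face_vertices f \<inter> white.
          meets_orthogonally (hb b) (hw w) (hF f)))"


(* Non-degeneracy. If the two white spheres of a face coincide, they have no
   distinguished point of contact; if the four centers around a black vertex are collinear, they
   do not span a plane and do not determine a circle. *)
definition distinct_spheres :: "(vertex \<Rightarrow> osphere) \<Rightarrow> bool" where
  "distinct_spheres c \<longleftrightarrow> (\<forall>f. inj_on c (face_vertices f \<inter> white))"

definition noncollinear_centers :: "(vertex \<Rightarrow> osphere) \<Rightarrow> bool" where
  "noncollinear_centers c \<longleftrightarrow> (\<forall>b\<in>black. \<not> collinear ((\<lambda>w. center (c w)) ` neighbours b))"

definition distinct_contact_points :: "(face \<Rightarrow> point) \<Rightarrow> bool" where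
  "distinct_contact_points hF \<longleftrightarrow> (\<forall>f. \<forall>f'\<in>neighbours f. hF f \<noteq> hF f')"

end

theory Submission
  imports Defs
begin

text \<open>Give each timelike sphere a signed radius r, positive for outwards orientation. Oriented contact
  of two spheres with centers m, m' then means that m + r n = m' + r' n for a unit normal n, and
  an oriented isotropic line touches both iff it passes through their contact point, with a null
  direction d orthogonal to n, and its half-plane contains the direction n. Given a congruence, the circle at a
  black vertex is therefore the section of the null-sphere there by the plane of the neighbouring
  white centers.

  Conversely, at a contact point there are two possible lines, told apart by the sign in
  n \<times> d = \<plusminus> d for the Lorentzian cross product, that is, by the rulings of the white spheres that
  contain them. The lines of adjacent faces meet in a point on a common white sphere, so they belong to
  different rulings of it. The signs hence alternate over the faces like the colours of a
  chessboard, and one global sign is left to choose. For each choice the lines through the four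
  contact points on a circle meet in one of the two centers of null-spheres through this circle.\<close>

section \<open>The Lorentz product and cross product\<close>

text \<open>Each non-degeneracy hypothesis excludes one collapse. Distinct white spheres of a face
  have distinct signed radii: a common isotropic line makes the squared distance of their centers
  equal to the squared difference of the radii, and in the spacelike plane around a black vertex a
  null difference of centers vanishes. Noncollinear centers keep the center of the null-sphere at a
  black vertex off that plane: otherwise all contact points around the vertex would coincide with
  it, and the four white centers would lie on one line through it. Distinct contact points keep the
  lines of adjacent faces apart, because distinct points of one spacelike circle are never joined by
  a null vector. Rulings are treated as eigenvalue equations. On the orthogonal complement of a unit
  vector n the map \<open>lcross n\<close> squares to the identity, and its eigenvectors there, for
  1 and -1, are exactly the two null directions. Comparing lines at different points of a sphere
  then reduces to skew-symmetry of the cross product, without parametrizing the sphere.\<close>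

lemma lor_add_left: "lor (x + y) z = lor x z + lor y z"
  and lor_add_right: "lor z (x + y) = lor z x + lor z y"
  and lor_diff_left: "lor (x - y) z = lor x z - lor y z"
  and lor_diff_right: "lor z (x - y) = lor z x - lor z y"
  and lor_scaleR_left: "lor (a *\<^sub>R x) z = a * lor x z"
  and lor_scaleR_right: "lor z (a *\<^sub>R x) = a * lor z x"
  and lor_minus_left: "lor (- x) z = - lor x z"
  and lor_minus_right: "lor z (- x) = - lor z x"
  and lor_zero_left: "lor 0 z = 0"
  and lor_zero_right: "lor z 0 = 0"
  by (simp_all add: lor_def algebra_simps)

lemmas lor_simps = lor_add_left lor_add_right lor_diff_left lor_diff_right
  lor_scaleR_left lor_scaleR_right lor_minus_left lor_minus_right lor_zero_left lor_zero_right

lemma lor_commute: "lor x y = lor y x"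
  by (simp add: lor_def mult.commute)

lemma vec3_eq_iff: "(x::point) = y \<longleftrightarrow> x $ 1 = y $ 1 \<and> x $ 2 = y $ 2 \<and> x $ 3 = y $ 3"
  by (simp add: vec_eq_iff forall_3)

lemma lor_nondegenerate:
  assumes "\<And>w. lor v w = 0" shows "v = 0"
  using assms[of "vector [1, 0, 0]"] assms[of "vector [0, 1, 0]"] assms[of "vector [0, 0, 1]"]
  by (simp add: lor_def vec3_eq_iff)

text \<open>Subtract from e the multiple of d that cancels its third coordinate. The remainder is
  again null, and on vectors with third coordinate 0 the form is positive definite.\<close>

lemma null_orthogonal_imp_parallel:
  assumes "d \<noteq> 0" "lor d d = 0" "lor e e = 0" "lor d e = 0"
  shows "\<exists>k. e = k *\<^sub>R d"
proof -
  have d: "(d $ 1)\<^sup>2 + (d $ 2)\<^sup>2 = (d $ 3)\<^sup>2" "(e $ 1)\<^sup>2 + (e $ 2)\<^sup>2 = (e $ 3)\<^sup>2"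
    "d $ 1 * e $ 1 + d $ 2 * e $ 2 = d $ 3 * e $ 3"
    using assms by (simp_all add: lor_def power2_eq_square)
  have d3: "d $ 3 \<noteq> 0"
  proof
    assume "d $ 3 = 0"
    with d(1) have "d $ 1 = 0" "d $ 2 = 0" by (auto simp: sum_power2_eq_zero_iff)
    with \<open>d $ 3 = 0\<close> \<open>d \<noteq> 0\<close> show False by (simp add: vec3_eq_iff)
  qed
  define k where "k = e $ 3 / d $ 3"
  have k: "e $ 3 = k * d $ 3" using d3 by (simp add: k_def)
  have "(e $ 1 - k * d $ 1)\<^sup>2 + (e $ 2 - k * d $ 2)\<^sup>2
      = ((e $ 1)\<^sup>2 + (e $ 2)\<^sup>2) - 2 * k * (d $ 1 * e $ 1 + d $ 2 * e $ 2)
        + k\<^sup>2 * ((d $ 1)\<^sup>2 + (d $ 2)\<^sup>2)"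
    by (simp add: power2_eq_square algebra_simps)
  also have "\<dots> = 0" unfolding d k by (simp add: power2_eq_square algebra_simps)
  finally have "e $ 1 = k * d $ 1" "e $ 2 = k * d $ 2"
    by (auto simp: sum_power2_eq_zero_iff)
  with k show ?thesis by (intro exI[of _ k]) (simp add: vec3_eq_iff)
qed

text \<open>The Euclidean cross product with its third coordinate negated. With this sign
  \<open>lor (lcross x y) z\<close> is the determinant of x, y, z, which explains the orthogonality
  relations and the skew-symmetry of \<open>lcross x\<close> below.\<close>

definition lcross :: "point \<Rightarrow> point \<Rightarrow> point" where
  "lcross x y = vector [x $ 2 * y $ 3 - x $ 3 * y $ 2, x $ 3 * y $ 1 - x $ 1 * y $ 3,
     x $ 2 * y $ 1 - x $ 1 * y $ 2]"

lemma lcross_add_left: "lcross (x + y) z = lcross x z + lcross y z"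
  and lcross_add_right: "lcross z (x + y) = lcross z x + lcross z y"
  and lcross_diff_left: "lcross (x - y) z = lcross x z - lcross y z"
  and lcross_diff_right: "lcross z (x - y) = lcross z x - lcross z y"
  and lcross_scaleR_left: "lcross (a *\<^sub>R x) z = a *\<^sub>R lcross x z"
  and lcross_scaleR_right: "lcross z (a *\<^sub>R x) = a *\<^sub>R lcross z x"
  and lcross_self: "lcross x x = 0"
  by (simp_all add: lcross_def vec3_eq_iff algebra_simps)

lemmas lcross_simps = lcross_add_left lcross_add_right lcross_diff_left lcross_diff_right
  lcross_scaleR_left lcross_scaleR_right lcross_self

lemma lor_lcross_left: "lor x (lcross x y) = 0"
  and lor_lcross_right: "lor y (lcross x y) = 0"
  by (simp_all add: lor_def lcross_def algebra_simps)

lemma lor_lcross_swap: "lor (lcross x y) z = - lor y (lcross x z)"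
  by (simp add: lor_def lcross_def algebra_simps)

text \<open>The sign is opposite to the Euclidean one. For a unit vector n, \<open>lcross n\<close>
  therefore squares to the identity on the orthogonal complement of n, instead of to its negative,
  and has real eigenvalues there.\<close>

lemma lcross_lcross: "lcross x (lcross y z) = lor x y *\<^sub>R z - lor x z *\<^sub>R y"
  by (simp add: lor_def lcross_def vec3_eq_iff algebra_simps)

lemma lor_lcross_lcross:
  "lor (lcross x y) (lcross x y) = (lor x y)\<^sup>2 - lor x x * lor y y"
  by (simp add: lor_def lcross_def power2_eq_square algebra_simps)

lemma lcross_eigen_null:
  assumes "lcross n d = \<sigma> *\<^sub>R d" "\<sigma> \<noteq> 0"
  shows "lor d d = 0" "lor n d = 0"
  using lor_lcross_right[of d n] lor_lcross_left[of n d] assms by (simp_all add: lor_simps)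

text \<open>\<open>lcross n d\<close> is null and orthogonal to the null vector d, so it is a
  multiple of d; the factor squares to 1 because \<open>lcross n\<close> is an involution on the
  orthogonal complement of n.\<close>

lemma null_imp_lcross_eigen:
  assumes "lor n n = 1" "lor n d = 0" "lor d d = 0"
  shows "lcross n d = d \<or> lcross n d = - d"
proof (cases "d = 0")
  case True
  then show ?thesis by (simp add: lcross_def vec3_eq_iff)
next
  case False
  have "lor (lcross n d) (lcross n d) = 0" using assms by (simp add: lor_lcross_lcross)
  then obtain k where k: "lcross n d = k *\<^sub>R d"
    using null_orthogonal_imp_parallel[OF False assms(3)] lor_lcross_right by blast
  have "lcross n (lcross n d) = d" using assms by (simp add: lcross_lcross)
  then have "(k * k) *\<^sub>R d = 1 *\<^sub>R d" by (simp add: k lcross_simps)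
  then have "k * k = 1" using False by (metis scaleR_right_imp_eq)
  then have "k = 1 \<or> k = -1" by (simp add: square_eq_1_iff)
  with k show ?thesis by auto
qed

text \<open>Lines of one ruling of a timelike sphere do not meet, unless they are equal: the
  directions of two such lines through X are eigenvectors of the cross product with the normal
  at X, for the same eigenvalue.\<close>

lemma same_ruling_parallel:
  assumes "lcross n d = \<sigma> *\<^sub>R d" "lcross n' d' = \<sigma> *\<^sub>R d'" "\<sigma> \<noteq> 0" "d \<noteq> 0" "r \<noteq> 0"
    and "r *\<^sub>R n + t *\<^sub>R d = r *\<^sub>R n' + t' *\<^sub>R d'"
  shows "\<exists>k. d' = k *\<^sub>R d"
proof -
  define X where "X = r *\<^sub>R n + t *\<^sub>R d"
  have "lcross X d = (r * \<sigma>) *\<^sub>R d"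
    by (simp add: X_def lcross_simps assms(1))
  moreover have "lcross X d' = (r * \<sigma>) *\<^sub>R d'"
    unfolding X_def assms(6) by (simp add: lcross_simps assms(2))
  \<comment> \<open>\<open>lcross X\<close> is skew with respect to \<open>lor\<close>, and d and d'
    are eigenvectors for the same eigenvalue, so their product equals its own negative.\<close>
  ultimately have "(r * \<sigma>) * lor d d' = - ((r * \<sigma>) * lor d d')"
    using lor_lcross_swap[of X d d'] by (simp add: lor_simps)
  then have "lor d d' = 0" using assms by simp
  then show ?thesis
    using null_orthogonal_imp_parallel assms(4) lcross_eigen_null(1)[OF assms(1,3)]
      lcross_eigen_null(1)[OF assms(2,3)] by blast
qed

text \<open>Write T for \<open>lcross n\<close> and e for the time axis \<open>axis 3 1\<close>. For
  unit n the cube of T equals T, so T (T e) + \<sigma> T e is an eigenvector for \<sigma> when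
  \<sigma> is 1 or -1. The choice of e makes it nonzero: its third coordinate is 1 plus the square
  of that of n.\<close>

definition null_dir :: "point \<Rightarrow> real \<Rightarrow> point" where
  "null_dir n \<sigma> = lcross n (lcross n (axis 3 1)) + \<sigma> *\<^sub>R lcross n (axis 3 1)"

lemma null_dir_nonzero:
  assumes "lor n n = 1" shows "null_dir n \<sigma> \<noteq> 0"
proof
  assume "null_dir n \<sigma> = 0"
  then have "null_dir n \<sigma> $ 3 = 0" by simp
  then have "1 + (n $ 3)\<^sup>2 = 0"
    unfolding null_dir_def lcross_lcross assms
    by (simp add: lcross_def lor_def axis_def power2_eq_square)
  moreover have "(n $ 3)\<^sup>2 \<ge> 0" by simp
  ultimately show False by linarith
qed

lemma lcross_null_dir:
  assumes "lor n n = 1" "\<sigma> * \<sigma> = 1"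
  shows "lcross n (null_dir n \<sigma>) = \<sigma> *\<^sub>R null_dir n \<sigma>"
proof -
  have "lcross n (lcross n (lcross n x)) = lcross n x" for x
    using assms(1) by (simp add: lcross_lcross[of n n "lcross n x"] lor_lcross_left)
  then show ?thesis
    using assms(2) by (simp add: null_dir_def lcross_simps scaleR_add_right)
qed

definition lorthonormal :: "point \<Rightarrow> point \<Rightarrow> bool" where
  "lorthonormal u v \<longleftrightarrow> lor u u = 1 \<and> lor v v = 1 \<and> lor u v = 0"

text \<open>The orthogonal complement of a spacelike plane is the line of its timelike normal \<nu>
  = \<open>lcross u v\<close>, and no nonzero multiple of \<nu> is null.\<close>

lemma orthogonal_spacelike_null_imp_zero:
  assumes "lorthonormal u v" "lor x u = 0" "lor x v = 0" "lor x x = 0"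
  shows "x = 0"
proof -
  define \<nu> where "\<nu> = lcross u v"
  have uv: "lor u u = 1" "lor v v = 1" "lor u v = 0"
    using assms(1) by (auto simp: lorthonormal_def)
  have n: "lor \<nu> \<nu> = -1" using uv by (simp add: \<nu>_def lor_lcross_lcross)
  have "lcross x \<nu> = 0" using assms by (simp add: \<nu>_def lcross_lcross)
  then have "lcross \<nu> x = 0" by (simp add: lcross_def vec3_eq_iff algebra_simps)
  then have "lcross \<nu> (lcross \<nu> x) = 0" by (simp add: lcross_def vec3_eq_iff)
  then have x: "x = - (lor \<nu> x) *\<^sub>R \<nu>"
    using n by (simp add: lcross_lcross) (metis minus_minus add.inverse_inverse)
  then have "lor x x = (- lor \<nu> x) * ((- lor \<nu> x) * lor \<nu> \<nu>)"
    by (metis lor_scaleR_left lor_scaleR_right)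
  with n assms(4) have "lor \<nu> x = 0" by simp
  with x show ?thesis by simp
qed

section \<open>Spacelike planes and circles\<close>

text \<open>Gram-Schmidt with respect to \<open>lor\<close>, which is positive definite on the
  direction space D.\<close>

lemma spacelike_planeE:
  assumes "spacelike_plane E" "p \<in> E"
  obtains u v where "lorthonormal u v" "\<And>x. x \<in> E \<longleftrightarrow> (\<exists>s t. x = p + s *\<^sub>R u + t *\<^sub>R v)"
proof -
  define D where "D = (\<lambda>x. x - p) ` E"
  have E: "affine E" "aff_dim E = 2" "\<And>x y. x \<in> E \<Longrightarrow> y \<in> E \<Longrightarrow> x \<noteq> y \<Longrightarrow> lor (x - y) (x - y) > 0"
    using assms(1) by (auto simp: spacelike_plane_def plane_def)
  have sub: "subspace D"
    unfolding D_def by (rule affine_diffs_subspace_subtract[OF E(1) assms(2)])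
  have "int (dim D) = 2"
    unfolding D_def using aff_dim_eq_dim_subtract[of p E] E(2) assms(2) by (simp add: hull_inc)
  then have "dim D = 2" by simp
  then obtain B where B: "B \<subseteq> D" "independent B" "span B = D" "card B = 2"
    using basis_subspace_exists[OF sub] by metis
  then obtain a b where ab: "B = {a, b}" "a \<noteq> b" by (auto simp: card_2_iff)
  have pos: "lor x x > 0" if "x \<in> D" "x \<noteq> 0" for x
  proof -
    from that(1) obtain y where "y \<in> E" "x = y - p" by (auto simp: D_def)
    with E(3)[of y p] assms(2) that(2) show ?thesis by auto
  qed
  have "a \<in> D" "b \<in> D" using B(1) ab by auto
  have "a \<noteq> 0" using B(2) ab dependent_zero by auto
  define u where "u = (1 / sqrt (lor a a)) *\<^sub>R a"
  have aa: "lor a a > 0" using pos \<open>a \<in> D\<close> \<open>a \<noteq> 0\<close> by auto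
  have uu: "lor u u = 1" using aa by (simp add: u_def lor_simps)
  have au: "a = sqrt (lor a a) *\<^sub>R u" using aa by (simp add: u_def)
  define b' where "b' = b - lor b u *\<^sub>R u"
  have "u \<in> D" unfolding u_def by (rule subspace_scale[OF sub \<open>a \<in> D\<close>])
  have "b' \<in> D" unfolding b'_def
    by (intro subspace_diff[OF sub] subspace_scale[OF sub] \<open>b \<in> D\<close> \<open>u \<in> D\<close>)
  have "b' \<noteq> 0"
  proof
    assume "b' = 0"
    then have "b \<in> span {a}"
      by (auto simp: b'_def u_def span_singleton)
    with B(2) ab show False
      by (metis dependent_def insert_commute Diff_insert_absorb insertI1 insert_iff singletonD singletonI)
  qed
  define v where "v = (1 / sqrt (lor b' b')) *\<^sub>R b'"
  have bb: "lor b' b' > 0" using pos \<open>b' \<in> D\<close> \<open>b' \<noteq> 0\<close> by auto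
  have vv: "lor v v = 1" using bb by (simp add: v_def lor_simps)
  have b'v: "b' = sqrt (lor b' b') *\<^sub>R v" using bb by (simp add: v_def)
  have "lor u b' = 0" by (simp add: b'_def lor_simps uu lor_commute)
  then have uv: "lor u v = 0" by (simp add: v_def lor_simps)
  have "v \<in> D" unfolding v_def by (rule subspace_scale[OF sub \<open>b' \<in> D\<close>])
  have "a \<in> span {u, v}" by (subst au) (simp add: span_base span_scale)
  moreover have "b \<in> span {u, v}"
  proof -
    have "b = lor b u *\<^sub>R u + sqrt (lor b' b') *\<^sub>R v" using b'v by (simp add: b'_def)
    then show ?thesis by (metis insertI1 insertI2 span_add span_base span_scale)
  qed
  ultimately have "span {a, b} \<subseteq> span {u, v}" by (intro span_minimal) auto
  moreover have "span {u, v} \<subseteq> D"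
    using \<open>u \<in> D\<close> \<open>v \<in> D\<close> sub by (intro span_minimal) auto
  ultimately have "D = span {u, v}" using B(3) ab by auto
  have D2: "x \<in> D \<longleftrightarrow> (\<exists>s t. x = s *\<^sub>R u + t *\<^sub>R v)" for x
  proof -
    have "x \<in> D \<longleftrightarrow> (\<exists>s t. x - s *\<^sub>R u = t *\<^sub>R v)"
      unfolding \<open>D = span {u, v}\<close> span_breakdown_eq by simp
    then show ?thesis by (simp add: diff_eq_eq add.commute)
  qed
  have "x \<in> E \<longleftrightarrow> (\<exists>s t. x = p + s *\<^sub>R u + t *\<^sub>R v)" for x
  proof -
    have "x \<in> E \<longleftrightarrow> x - p \<in> D" by (auto simp: D_def)
    then show ?thesis unfolding D2 by (simp add: diff_eq_eq algebra_simps)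
  qed
  with uu vv uv show thesis by (intro that[of u v]) (auto simp: lorthonormal_def)
qed

lemma spacelike_plane_null_diff:
  assumes "spacelike_plane E" "x \<in> E" "y \<in> E" "lor (x - y) (x - y) = 0"
  shows "x = y"
  using assms by (force simp: spacelike_plane_def)

lemma spacelike_plane_translate:
  assumes "spacelike_plane E" "x \<in> E" "y \<in> E" "z \<in> E"
  shows "x + a *\<^sub>R (y - z) \<in> E"
  using assms by (auto simp: spacelike_plane_def plane_def intro: mem_affine_3_minus)

lemma spacelike_plane_projection:
  assumes "spacelike_plane E"
  shows "\<exists>q\<in>E. \<forall>x\<in>E. \<forall>y\<in>E. lor (x - y) (m - q) = 0"
proof -
  have "E \<noteq> {}" using assms by (auto simp: spacelike_plane_def plane_def)
  then obtain p where "p \<in> E" by auto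
  obtain u v where uv: "lorthonormal u v"
    and E: "\<And>x. x \<in> E \<longleftrightarrow> (\<exists>s t. x = p + s *\<^sub>R u + t *\<^sub>R v)"
    using spacelike_planeE[OF assms \<open>p \<in> E\<close>] by blast
  define q where "q = p + lor (m - p) u *\<^sub>R u + lor (m - p) v *\<^sub>R v"
  have "lor u (m - q) = 0" "lor v (m - q) = 0"
    using uv by (auto simp: q_def lor_simps lorthonormal_def lor_commute)
  then have "lor (x - y) (m - q) = 0" if "x \<in> E" "y \<in> E" for x y
    using that unfolding E by (auto simp: lor_add_left lor_diff_left lor_scaleR_left)
  moreover have "q \<in> E" unfolding E q_def by blast
  ultimately show ?thesis by blast
qed

lemma orthogonal_spacelike_plane_null_imp_zero:
  assumes "spacelike_plane E" "\<forall>x\<in>E. \<forall>y\<in>E. lor (x - y) k = 0" "lor k k = 0"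
  shows "k = 0"
proof -
  have "E \<noteq> {}" using assms by (auto simp: spacelike_plane_def plane_def)
  then obtain p where "p \<in> E" by auto
  obtain u v where uv: "lorthonormal u v"
    and E: "\<And>x. x \<in> E \<longleftrightarrow> (\<exists>s t. x = p + s *\<^sub>R u + t *\<^sub>R v)"
    using spacelike_planeE[OF assms(1) \<open>p \<in> E\<close>] by blast
  have "p + u = p + 1 *\<^sub>R u + 0 *\<^sub>R v" "p + v = p + 0 *\<^sub>R u + 1 *\<^sub>R v" by simp_all
  then have "p + u \<in> E" "p + v \<in> E" unfolding E by metis+
  then have "lor u k = 0" "lor v k = 0"
    using assms(2) \<open>p \<in> E\<close> by (metis add_diff_cancel_left')+
  with orthogonal_spacelike_null_imp_zero[OF uv] assms(3) show ?thesis
    by (simp add: lor_commute)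
qed

section \<open>Spacelike circles of positive radius: tangent lines, uniqueness of plane and
  center\<close>

definition proper_circle :: "point set \<Rightarrow> point set \<Rightarrow> point \<Rightarrow> real \<Rightarrow> bool" where
  "proper_circle C E q R \<longleftrightarrow> spacelike_plane E \<and> q \<in> E \<and> R > 0 \<and> C = {x \<in> E. lor (x - q) (x - q) = R}"

lemma proper_circle_lsphere: "proper_circle C E q R \<Longrightarrow> C = E \<inter> lsphere q R"
  by (auto simp: proper_circle_def lsphere_def)

text \<open>Pythagoras: the spheres centered on the normal of E at q cut E in circles about q. This
  lets any sphere through a circle be replaced by the one whose center lies in the plane.\<close>

lemma sphere_section:
  assumes "q \<in> E" "\<forall>x\<in>E. \<forall>y\<in>E. lor (x - y) (m - q) = 0" "x \<in> E"
  shows "lor (x - m) (x - m) = lor (x - q) (x - q) + lor (m - q) (m - q)"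
proof -
  have "lor (x - q) (m - q) = 0" using assms by blast
  moreover have "lor (x - m) (x - m)
      = lor (x - q) (x - q) + lor (m - q) (m - q) - 2 * lor (x - q) (m - q)"
    by (simp add: lor_def algebra_simps)
  ultimately show ?thesis by simp
qed

text \<open>Moving the center m to its foot q in E changes neither the section nor the tangent line.
  The dimension of the tangent line rules out one-point circles: for p = q the tangent line would be
  all of E.\<close>

lemma circle_tangent_lineD:
  assumes "circle_tangent_line C p l"
  shows "\<exists>E q R. proper_circle C E q R \<and> p \<in> C \<and> l = {x \<in> E. lor (x - p) (p - q) = 0}"
proof -
  obtain E m \<rho> where E: "spacelike_plane E" "C = E \<inter> lsphere m \<rho>" "p \<in> C"
    "l = E \<inter> tangent_plane m p" "aff_dim l = 1"
    using assms by (auto simp: circle_tangent_line_def)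
  obtain q where q: "q \<in> E" "\<forall>x\<in>E. \<forall>y\<in>E. lor (x - y) (m - q) = 0"
    using spacelike_plane_projection[OF E(1)] by blast
  have p: "p \<in> E" "lor (p - m) (p - m) = \<rho>" using E by (auto simp: lsphere_def)
  define R where "R = lor (p - q) (p - q)"
  have l: "l = {x \<in> E. lor (x - p) (p - q) = 0}"
  proof -
    have "lor (x - p) (p - m) = lor (x - p) (p - q)" if "x \<in> E" for x
    proof -
      have "lor (x - p) (m - q) = 0" using q(2) that p(1) by blast
      then show ?thesis by (simp add: lor_simps)
    qed
    then show ?thesis by (auto simp: E(4) tangent_plane_def)
  qed
  have "p \<noteq> q"
  proof
    assume "p = q"
    then have "l = E" by (auto simp: l lor_simps)
    with E show False by (simp add: spacelike_plane_def plane_def)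
  qed
  then have "R > 0" using E(1) p q by (auto simp: R_def spacelike_plane_def)
  moreover have "C = {x \<in> E. lor (x - q) (x - q) = R}"
    using sphere_section[OF q] p by (auto simp: E(2) lsphere_def R_def)
  ultimately have "proper_circle C E q R" using E(1) q(1) by (simp add: proper_circle_def)
  then show ?thesis using E(3) l by blast
qed

lemma proper_circle_frame:
  assumes "proper_circle C E q R" "p \<in> C"
  shows "\<exists>n. lor n n = 1 \<and> lor n (p - q) = 0 \<and>
    (\<forall>x. x \<in> E \<longleftrightarrow> (\<exists>s t. x = p + s *\<^sub>R n + t *\<^sub>R (p - q)))"
proof -
  have E: "spacelike_plane E" "q \<in> E" "R > 0" "p \<in> E" "lor (p - q) (p - q) = R"
    using assms by (auto simp: proper_circle_def)
  obtain u v where uv: "lorthonormal u v"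
    and Ex: "\<And>x. x \<in> E \<longleftrightarrow> (\<exists>s t. x = q + s *\<^sub>R u + t *\<^sub>R v)"
    using spacelike_planeE[OF E(1,2)] by blast
  obtain a b where ab: "p = q + a *\<^sub>R u + b *\<^sub>R v" using Ex E(4) by blast
  have R: "a * a + b * b = R"
    using E(5) uv unfolding ab lorthonormal_def by (simp add: lor_simps lor_commute[of v u])
  \<comment> \<open>The radius p - q = a u + b v, turned by a right angle within E and divided by
    its length.\<close>
  define n where "n = (1 / sqrt R) *\<^sub>R (a *\<^sub>R v - b *\<^sub>R u)"
  have pq: "p - q = a *\<^sub>R u + b *\<^sub>R v" by (simp add: ab)
  have sR: "sqrt R * sqrt R = R" using E(3) by simp
  have "lor n n = (a * a + b * b) / (sqrt R * sqrt R)"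
    using uv unfolding n_def lorthonormal_def
    by (simp add: lor_simps lor_commute[of v u] add_divide_distrib)
  then have "lor n n = 1" using R sR E(3) by simp
  moreover have "lor n (p - q) = 0"
    using uv unfolding n_def lorthonormal_def pq
    by (simp add: lor_simps lor_commute[of v u])
  moreover have "x \<in> E \<longleftrightarrow> (\<exists>s t. x = p + s *\<^sub>R n + t *\<^sub>R (p - q))" for x
  proof
    assume "\<exists>s t. x = p + s *\<^sub>R n + t *\<^sub>R (p - q)"
    then obtain s t where "x = p + s *\<^sub>R n + t *\<^sub>R (p - q)" by blast
    then have "x = q + (a - s / sqrt R * b + t * a) *\<^sub>R u + (b + s / sqrt R * a + t * b) *\<^sub>R v"
      unfolding pq n_def by (simp add: ab algebra_simps)
    then show "x \<in> E" using Ex by blast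
  next
    assume "x \<in> E"
    then obtain c d where cd: "x = q + c *\<^sub>R u + d *\<^sub>R v" using Ex by blast
    define c' d' where "c' = c - a" and "d' = d - b"
    have "x = p + c' *\<^sub>R u + d' *\<^sub>R v" by (simp add: cd ab c'_def d'_def algebra_simps)
    moreover have "R *\<^sub>R u = a *\<^sub>R (p - q) - (b * sqrt R) *\<^sub>R n"
      using E(3) unfolding pq n_def by (simp add: algebra_simps flip: R)
    moreover have "R *\<^sub>R v = b *\<^sub>R (p - q) + (a * sqrt R) *\<^sub>R n"
      using E(3) unfolding pq n_def by (simp add: algebra_simps flip: R)
    moreover have "R *\<^sub>R (p + c' *\<^sub>R u + d' *\<^sub>R v - p) = c' *\<^sub>R (R *\<^sub>R u) + d' *\<^sub>R (R *\<^sub>R v)"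
      by (simp add: algebra_simps)
    ultimately have "R *\<^sub>R (x - p) = c' *\<^sub>R (a *\<^sub>R (p - q) - (b * sqrt R) *\<^sub>R n)
        + d' *\<^sub>R (b *\<^sub>R (p - q) + (a * sqrt R) *\<^sub>R n)"
      by metis
    then have "R *\<^sub>R (x - p) = (c' * a + d' * b) *\<^sub>R (p - q) + ((d' * a - c' * b) * sqrt R) *\<^sub>R n"
      by (simp add: algebra_simps)
    then have "(1 / R) *\<^sub>R (R *\<^sub>R (x - p)) =
        ((c' * a + d' * b) / R) *\<^sub>R (p - q) + ((d' * a - c' * b) * sqrt R / R) *\<^sub>R n"
      by (simp only: scaleR_add_right scaleR_scaleR) simp
    then have "x = p + ((d' * a - c' * b) * sqrt R / R) *\<^sub>R n + ((c' * a + d' * b) / R) *\<^sub>R (p - q)"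
      using E(3) by (simp add: diff_eq_eq ac_simps)
    then show "\<exists>s t. x = p + s *\<^sub>R n + t *\<^sub>R (p - q)" by blast
  qed
  ultimately show ?thesis by blast
qed

lemma proper_circle_tangent_line:
  assumes "proper_circle C E q R" "p \<in> C"
  shows "\<exists>n. lor n n = 1 \<and> lor n (p - q) = 0 \<and>
    {x \<in> E. lor (x - p) (p - q) = 0} = {p + s *\<^sub>R n | s. True}"
proof -
  obtain n where n: "lor n n = 1" "lor n (p - q) = 0"
    "\<And>x. x \<in> E \<longleftrightarrow> (\<exists>s t. x = p + s *\<^sub>R n + t *\<^sub>R (p - q))"
    using proper_circle_frame[OF assms] by blast
  have R: "lor (p - q) (p - q) > 0" using assms by (auto simp: proper_circle_def)
  have "{x \<in> E. lor (x - p) (p - q) = 0} = {p + s *\<^sub>R n | s. True}"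
  proof (intro equalityI subsetI; clarify)
    fix x assume x: "x \<in> E" "lor (x - p) (p - q) = 0"
    then obtain s t where st: "x = p + s *\<^sub>R n + t *\<^sub>R (p - q)" using n by blast
    have "t * lor (p - q) (p - q) = 0"
      using x(2) n(2) unfolding st by (simp add: lor_simps)
    then have "t = 0" using R by simp
    then show "\<exists>s. x = p + s *\<^sub>R n \<and> True" using st by auto
  next
    fix s
    have "p + s *\<^sub>R n = p + s *\<^sub>R n + 0 *\<^sub>R (p - q)" by simp
    then have "p + s *\<^sub>R n \<in> E" using n(3) by blast
    then show "p + s *\<^sub>R n \<in> E \<and> lor (p + s *\<^sub>R n - p) (p - q) = 0"
      using n(2) by (simp add: lor_scaleR_left)
  qed
  with n show ?thesis by blast
qed

lemma aff_dim_line: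
  fixes p n :: point
  assumes "n \<noteq> 0"
  shows "aff_dim {p + s *\<^sub>R n | s. True} = 1"
proof -
  have "{p + s *\<^sub>R n | s. True} = affine hull {p, p + n}"
  proof (intro equalityI subsetI; clarsimp simp: affine_hull_2)
    fix s show "\<exists>u v. p + s *\<^sub>R n = u *\<^sub>R p + v *\<^sub>R (p + n) \<and> u + v = 1"
      by (intro exI[of _ "1 - s"] exI[of _ s]) (simp add: algebra_simps)
  next
    fix u v :: real assume "u + v = 1"
    then have "u = 1 - v" by simp
    then show "\<exists>s. u *\<^sub>R p + v *\<^sub>R (p + n) = p + s *\<^sub>R n"
      by (intro exI[of _ v]) (simp add: scaleR_diff_left scaleR_add_right)
  qed
  then show ?thesis using assms by (simp add: aff_dim_2)
qed

lemma circle_tangent_lineI: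
  assumes "proper_circle C E q R" "p \<in> C"
  shows "circle_tangent_line C p {x \<in> E. lor (x - p) (p - q) = 0}"
proof -
  obtain n where n: "lor n n = 1"
    "{x \<in> E. lor (x - p) (p - q) = 0} = {p + s *\<^sub>R n | s. True}"
    using proper_circle_tangent_line[OF assms] by blast
  then have "n \<noteq> 0" by (auto simp: lor_simps)
  then have "aff_dim {x \<in> E. lor (x - p) (p - q) = 0} = 1"
    unfolding n(2) by (rule aff_dim_line)
  moreover have "{x \<in> E. lor (x - p) (p - q) = 0} = E \<inter> tangent_plane q p"
    by (auto simp: tangent_plane_def)
  moreover have "spacelike_plane E" using assms(1) by (simp add: proper_circle_def)
  ultimately show ?thesis
    unfolding circle_tangent_line_def using assms(2) proper_circle_lsphere[OF assms(1)] by blast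
qed

lemma proper_circle_spacelike_circle: "proper_circle C E q R \<Longrightarrow> p \<in> C \<Longrightarrow> spacelike_circle C"
  unfolding spacelike_circle_def circle_def using proper_circle_lsphere
  by (metis (no_types, lifting) Int_lower1 empty_iff proper_circle_def spacelike_plane_def)

text \<open>The ends of two perpendicular diameters. These four points are enough to recover the
  plane and the center from the point set C.\<close>

lemma proper_circle_antipodal:
  assumes "proper_circle C E q R" "lorthonormal u v"
    "\<And>x. x \<in> E \<longleftrightarrow> (\<exists>s t. x = q + s *\<^sub>R u + t *\<^sub>R v)"
  shows "q + sqrt R *\<^sub>R u \<in> C" "q - sqrt R *\<^sub>R u \<in> C"
    "q + sqrt R *\<^sub>R v \<in> C" "q - sqrt R *\<^sub>R v \<in> C"
proof -
  have "q + s *\<^sub>R u + t *\<^sub>R v \<in> C" if "s * s + t * t = R" for s t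
  proof -
    have "q + s *\<^sub>R u + t *\<^sub>R v - q = s *\<^sub>R u + t *\<^sub>R v" by simp
    moreover have "lor (s *\<^sub>R u + t *\<^sub>R v) (s *\<^sub>R u + t *\<^sub>R v) = R"
      using assms(2) that by (simp add: lorthonormal_def lor_simps lor_commute[of v u])
    ultimately show ?thesis using assms(1,3) by (auto simp: proper_circle_def)
  qed
  from this[of "sqrt R" 0] this[of "- sqrt R" 0] this[of 0 "sqrt R"] this[of 0 "- sqrt R"]
  show "q + sqrt R *\<^sub>R u \<in> C" "q - sqrt R *\<^sub>R u \<in> C"
    "q + sqrt R *\<^sub>R v \<in> C" "q - sqrt R *\<^sub>R v \<in> C"
    using assms(1) by (auto simp: proper_circle_def)
qed

lemma proper_circle_plane_subset:
  assumes "proper_circle C E q R" "proper_circle C E' q' R'"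
  shows "E \<subseteq> E'"
proof
  fix x assume "x \<in> E"
  obtain u v where uv: "lorthonormal u v"
    and Ex: "\<And>x. x \<in> E \<longleftrightarrow> (\<exists>s t. x = q + s *\<^sub>R u + t *\<^sub>R v)"
    using spacelike_planeE assms(1) unfolding proper_circle_def by metis
  note C = proper_circle_antipodal[OF assms(1) uv Ex]
  have CE: "y \<in> E'" if "y \<in> C" for y using that assms(2) by (auto simp: proper_circle_def)
  have E': "spacelike_plane E'" using assms(2) by (auto simp: proper_circle_def)
  have R: "sqrt R \<noteq> 0" using assms(1) by (auto simp: proper_circle_def)
  obtain s t where st: "x = q + s *\<^sub>R u + t *\<^sub>R v" using \<open>x \<in> E\<close> Ex by blast
  \<comment> \<open>The direction w of a diameter is a multiple of a difference of two points of C,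
    hence a direction of E'.\<close>
  have *: "y + a *\<^sub>R w \<in> E'" if "y \<in> E'" "q + sqrt R *\<^sub>R w \<in> C" "q - sqrt R *\<^sub>R w \<in> C" for y a w
  proof -
    have "(q + sqrt R *\<^sub>R w) - (q - sqrt R *\<^sub>R w) = (2 * sqrt R) *\<^sub>R w"
      by (simp add: vec3_eq_iff)
    then have "(a / (2 * sqrt R)) *\<^sub>R ((q + sqrt R *\<^sub>R w) - (q - sqrt R *\<^sub>R w)) = a *\<^sub>R w"
      using R by simp
    then show ?thesis
      using spacelike_plane_translate[OF E' that(1) CE[OF that(2)] CE[OF that(3)]] by metis
  qed
  have "q + sqrt R *\<^sub>R u + (s - sqrt R) *\<^sub>R u \<in> E'"
    by (intro * CE C)
  then have "q + s *\<^sub>R u \<in> E'" by (simp add: algebra_simps)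
  then show "x \<in> E'" unfolding st by (rule *[OF _ C(3,4)])
qed

lemma proper_circle_unique:
  assumes "proper_circle C E q R" "proper_circle C E' q' R'"
  shows "E = E'" "q = q'"
proof -
  show EE: "E = E'" using proper_circle_plane_subset assms by blast
  obtain u v where uv: "lorthonormal u v"
    and Ex: "\<And>x. x \<in> E \<longleftrightarrow> (\<exists>s t. x = q + s *\<^sub>R u + t *\<^sub>R v)"
    using spacelike_planeE assms(1) unfolding proper_circle_def by metis
  note C = proper_circle_antipodal[OF assms(1) uv Ex]
  have R: "sqrt R \<noteq> 0" using assms(1) by (auto simp: proper_circle_def)
  \<comment> \<open>Both ends of a diameter of direction w have the same squared distance from q',
    so q - q' is orthogonal to w.\<close>
  have *: "lor w (q - q') = 0" if "q + sqrt R *\<^sub>R w \<in> C" "q - sqrt R *\<^sub>R w \<in> C" for w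
  proof -
    have "lor (q + sqrt R *\<^sub>R w - q') (q + sqrt R *\<^sub>R w - q') = R'"
      "lor (q - sqrt R *\<^sub>R w - q') (q - sqrt R *\<^sub>R w - q') = R'"
      using that assms(2) by (auto simp: proper_circle_def)
    moreover have "lor (q + sqrt R *\<^sub>R w - q') (q + sqrt R *\<^sub>R w - q')
        - lor (q - sqrt R *\<^sub>R w - q') (q - sqrt R *\<^sub>R w - q') = 4 * (sqrt R * lor w (q - q'))"
      by (simp add: lor_def algebra_simps)
    ultimately show ?thesis using R by simp
  qed
  have "lor u (q - q') = 0" "lor v (q - q') = 0" using * C by blast+
  moreover have "q' \<in> E" using assms EE by (auto simp: proper_circle_def)
  then obtain s t where st: "q' = q + s *\<^sub>R u + t *\<^sub>R v" using Ex by blast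
  ultimately have "s = 0" "t = 0"
    using uv by (auto simp: lorthonormal_def lor_simps lor_commute[of v u])
  then show "q = q'" using st by simp
qed

text \<open>The vectors orthogonal to the tangent plane of a timelike sphere at p are the multiples
  of the radius p - m. Hence orthogonality says that the tangent line of the circle passes through
  the center of the sphere.\<close>

lemma meets_orthogonally_proper_circle:
  assumes "proper_circle C E q R" "timelike s"
  shows "meets_orthogonally C s p \<longleftrightarrow>
    p \<in> C \<and> p \<in> points s \<and> center s \<in> E \<and> lor (center s - p) (p - q) = 0"
proof
  obtain m \<rho> e where s: "s = Timelike m \<rho> e" "\<rho> > 0"
    using assms(2) by (auto simp: timelike_def)
  {
    assume "meets_orthogonally C s p"
    then obtain l where l: "p \<in> C" "p \<in> points s" "circle_tangent_line C p l"
      "\<forall>x\<in>l. \<forall>y\<in>tangent_plane (center s) p. lor (x - p) (y - p) = 0"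
      by (auto simp: meets_orthogonally_def)
    obtain E' q' R' where "proper_circle C E' q' R'" "l = {x \<in> E'. lor (x - p) (p - q') = 0}"
      using circle_tangent_lineD[OF l(3)] by blast
    with proper_circle_unique[OF assms(1)] have l2: "l = {x \<in> E. lor (x - p) (p - q) = 0}" by blast
    obtain n where n: "lor n n = 1" "l = {p + s *\<^sub>R n | s. True}"
      using proper_circle_tangent_line[OF assms(1) l(1)] l2 by blast
    define N where "N = p - m"
    have NN: "lor N N = \<rho>" using l(2) by (simp add: s N_def lsphere_def)
    have "p + n \<in> l" by (simp add: n(2)) (metis scaleR_one)
    have nw: "lor n w = 0" if "lor w N = 0" for w
    proof -
      have "p + w \<in> tangent_plane (center s) p" using that by (simp add: tangent_plane_def s N_def)
      with l(4) \<open>p + n \<in> l\<close> show ?thesis by (metis add_diff_cancel_left')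
    qed
    \<comment> \<open>With this c, n - c N is orthogonal to N. It is also orthogonal to every
      tangent vector w', so it is orthogonal to everything and vanishes.\<close>
    define c where "c = lor n N / \<rho>"
    have "lor (n - c *\<^sub>R N) w = 0" for w
    proof -
      define w' where "w' = w - (lor w N / \<rho>) *\<^sub>R N"
      have "lor w' N = 0" using NN s(2) by (simp add: w'_def lor_simps)
      then have "lor n w' = 0" by (rule nw)
      then show ?thesis using s(2) by (simp add: w'_def c_def lor_simps lor_commute[of N w])
    qed
    then have nN: "n = c *\<^sub>R N" using lor_nondegenerate[of "n - c *\<^sub>R N"] by simp
    with n(1) have "c \<noteq> 0" by (auto simp: lor_simps)
    with nN have "N = (1 / c) *\<^sub>R n" by simp
    then have "m = p + (- 1 / c) *\<^sub>R n" unfolding N_def by (simp add: algebra_simps)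
    then have "m \<in> l" unfolding n(2) by blast
    then show "p \<in> C \<and> p \<in> points s \<and> center s \<in> E \<and> lor (center s - p) (p - q) = 0"
      using l(1,2) by (simp add: l2 s)
  }
  {
    assume *: "p \<in> C \<and> p \<in> points s \<and> center s \<in> E \<and> lor (center s - p) (p - q) = 0"
    obtain n where n: "{x \<in> E. lor (x - p) (p - q) = 0} = {p + s *\<^sub>R n | s. True}"
      using proper_circle_tangent_line[OF assms(1) conjunct1[OF *]] by blast
    have "m \<in> {x \<in> E. lor (x - p) (p - q) = 0}" using * by (simp add: s)
    then obtain a where a: "m = p + a *\<^sub>R n" unfolding n by blast
    have "m \<noteq> p" using * s by (auto simp: lsphere_def lor_simps)
    then have "a \<noteq> 0" using a by auto
    have "lor (x - p) (y - p) = 0"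
      if x: "x \<in> {x \<in> E. lor (x - p) (p - q) = 0}" and y: "y \<in> tangent_plane (center s) p" for x y
    proof -
      obtain b where b: "x = p + b *\<^sub>R n" using x unfolding n by blast
      have "lor (y - p) (- (a *\<^sub>R n)) = 0" using y by (simp add: tangent_plane_def s a)
      then have "lor (y - p) n = 0" using \<open>a \<noteq> 0\<close> by (simp add: lor_simps)
      then show ?thesis by (simp add: b lor_scaleR_left lor_commute[of n])
    qed
    then show "meets_orthogonally C s p"
      unfolding meets_orthogonally_def using * circle_tangent_lineI[OF assms(1)] by blast
  }
qed

section \<open>Oriented contact of spheres and isotropic lines\<close>

definition sradius :: "osphere \<Rightarrow> real" where
  "sradius s = (case orient s of Outwards \<Rightarrow> sqrt (sqradius s) | Inwards \<Rightarrow> - sqrt (sqradius s))"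

lemma timelike_sradius:
  assumes "timelike s"
  shows "sradius s \<noteq> 0" "sqradius s = sradius s * sradius s"
    "orient s = Outwards \<longleftrightarrow> sradius s > 0"
    "points s = {x. lor (x - center s) (x - center s) = sradius s * sradius s}"
    "s = Timelike (center s) (sqradius s) (orient s)"
  using assms by (auto simp: timelike_def sradius_def lsphere_def split: orientation.splits)

lemma timelike_eqI:
  assumes "timelike s" "timelike s'" "center s = center s'" "sradius s = sradius s'"
  shows "s = s'"
  using timelike_sradius[OF assms(1)] timelike_sradius[OF assms(2)] assms(3,4)
  by (metis orientation.exhaust)

text \<open>The sign of the radius absorbs the case distinction on the orientation.\<close>

lemma oriented_tangent_plane_sradius:
  assumes "timelike s"
  shows "oriented_tangent_plane s p =
    (tangent_plane (center s) p, {x. lor (x - p) (sradius s *\<^sub>R (p - center s)) > 0})"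
  using timelike_sradius[OF assms]
  by (cases "orient s")
    (auto simp: oriented_tangent_plane_def lor_scaleR_right zero_less_mult_iff mult_less_0_iff)

text \<open>A non-null a splits the space into its multiples and its orthogonal complement. This
  turns equality of tangent planes into parallel radii.\<close>

lemma orthogonal_complement_subset_imp_parallel:
  assumes "lor a a \<noteq> 0" "\<And>w. lor w a = 0 \<Longrightarrow> lor w b = 0"
  shows "b = (lor b a / lor a a) *\<^sub>R a"
proof -
  define c where "c = lor b a / lor a a"
  have "lor (b - c *\<^sub>R a) w = 0" for w
  proof -
    define w' where "w' = w - (lor w a / lor a a) *\<^sub>R a"
    have "lor w' a = 0" using assms(1) by (simp add: w'_def lor_simps)
    then have "lor w' b = 0" by (rule assms(2))
    then show ?thesis
      by (simp add: w'_def c_def lor_simps lor_commute[of w b] lor_commute[of a b] lor_commute[of a w])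
  qed
  then show ?thesis using lor_nondegenerate[of "b - c *\<^sub>R a"] by (simp add: c_def)
qed

lemma oriented_contact_iff:
  assumes "timelike s" "timelike s'"
  shows "oriented_contact s s' \<longleftrightarrow>
    (\<exists>n. lor n n = 1 \<and> center s + sradius s *\<^sub>R n = center s' + sradius s' *\<^sub>R n)"
proof -
  define m m' r r' where "m = center s" and "m' = center s'" and "r = sradius s" and "r' = sradius s'"
  note defs = m_def[symmetric] m'_def[symmetric] r_def[symmetric] r'_def[symmetric]
  have r: "r \<noteq> 0" "r' \<noteq> 0" using timelike_sradius assms by (auto simp: r_def r'_def)
  have "oriented_contact s s' \<longleftrightarrow> (\<exists>p. lor (p - m) (p - m) = r * r \<and> lor (p - m') (p - m') = r' * r' \<and>
      tangent_plane m p = tangent_plane m' p \<and>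
      {x. lor (x - p) (r *\<^sub>R (p - m)) > 0} = {x. lor (x - p) (r' *\<^sub>R (p - m')) > 0})"
    unfolding oriented_contact_def oriented_tangent_plane_sradius[OF assms(1)]
      oriented_tangent_plane_sradius[OF assms(2)] timelike_sradius(4)[OF assms(1)]
      timelike_sradius(4)[OF assms(2)] defs using assms by simp
  also have "\<dots> \<longleftrightarrow> (\<exists>n. lor n n = 1 \<and> m + r *\<^sub>R n = m' + r' *\<^sub>R n)"
  proof (intro iffI; elim exE conjE)
    fix p assume p: "lor (p - m) (p - m) = r * r" "lor (p - m') (p - m') = r' * r'"
      "tangent_plane m p = tangent_plane m' p"
      "{x. lor (x - p) (r *\<^sub>R (p - m)) > 0} = {x. lor (x - p) (r' *\<^sub>R (p - m')) > 0}"
    define c where "c = lor (p - m') (p - m) / lor (p - m) (p - m)"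
    have c: "p - m' = c *\<^sub>R (p - m)" unfolding c_def
    proof (rule orthogonal_complement_subset_imp_parallel)
      show "lor (p - m) (p - m) \<noteq> 0" using p(1) r by simp
      fix w assume "lor w (p - m) = 0"
      then have "p + w \<in> tangent_plane m p" by (simp add: tangent_plane_def)
      then have "p + w \<in> tangent_plane m' p" using p(3) by simp
      then show "lor w (p - m') = 0" by (simp add: tangent_plane_def)
    qed
    have "(c * r) * (c * r) = c * (c * lor (p - m) (p - m))" using p(1) by simp
    also have "\<dots> = r' * r'" using p(2) unfolding c by (simp add: lor_scaleR_left lor_scaleR_right)
    finally have cr: "(c * r) * (c * r) = r' * r'" .
    \<comment> \<open>So far c r is only known to be r' or -r'. A test point of the first
      half-space, which must also lie in the second, decides the sign.\<close>
    have "p + r *\<^sub>R (p - m) \<in> {x. lor (x - p) (r *\<^sub>R (p - m)) > 0}"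
      using p(1) r by (simp add: lor_scaleR_left lor_scaleR_right) 
        (metis mult.assoc not_real_square_gt_zero mult_eq_0_iff)
    then have "p + r *\<^sub>R (p - m) \<in> {x. lor (x - p) (r' *\<^sub>R (p - m')) > 0}" using p(4) by simp
    then have "(r * r) * (r * c * r') > 0" using p(1)
      by (simp add: c lor_scaleR_left lor_scaleR_right mult_ac)
    then have "r * c * r' > 0" by (simp add: zero_less_mult_iff)
    with cr have "c * r = r'" using r
      by (smt (verit, ccfv_threshold) mult.commute mult_minus_left not_real_square_gt_zero square_eq_iff)
    then have "(1 / r') *\<^sub>R (p - m') = (1 / r) *\<^sub>R (p - m)" unfolding c using r by auto
    moreover have "lor ((1 / r) *\<^sub>R (p - m)) ((1 / r) *\<^sub>R (p - m)) = 1"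
      using p(1) r by (simp add: lor_scaleR_left lor_scaleR_right)
    moreover have "m + r *\<^sub>R ((1 / r) *\<^sub>R (p - m)) = m' + r' *\<^sub>R ((1 / r') *\<^sub>R (p - m'))"
      using r by simp
    ultimately show "\<exists>n. lor n n = 1 \<and> m + r *\<^sub>R n = m' + r' *\<^sub>R n" by metis
  next
    fix n assume n: "lor n n = 1" "m + r *\<^sub>R n = m' + r' *\<^sub>R n"
    define p where "p = m + r *\<^sub>R n"
    have p: "p - m = r *\<^sub>R n" "p - m' = r' *\<^sub>R n" by (simp add: p_def) (simp add: p_def n(2))
    have "r * r > 0" "r' * r' > 0" using r by (simp_all add: zero_less_mult_iff) linarith+
    then show "\<exists>p. lor (p - m) (p - m) = r * r \<and> lor (p - m') (p - m') = r' * r' \<and>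
      tangent_plane m p = tangent_plane m' p \<and>
      {x. lor (x - p) (r *\<^sub>R (p - m)) > 0} = {x. lor (x - p) (r' *\<^sub>R (p - m')) > 0}"
      using n(1) r by (intro exI[of _ p])
        (simp add: p tangent_plane_def lor_scaleR_left lor_scaleR_right zero_less_mult_iff
          flip: mult.assoc)
  qed
  finally show ?thesis unfolding defs .
qed

text \<open>Oriented contact of two different spheres, expressed by centers and signed radii. For
  equal radii the equation would only say that the centers differ by a null vector.\<close>

definition touching :: "osphere \<Rightarrow> osphere \<Rightarrow> bool" where
  "touching s s' \<longleftrightarrow> timelike s \<and> timelike s' \<and> sradius s \<noteq> sradius s' \<and>
     lor (center s - center s') (center s - center s') = (sradius s - sradius s')\<^sup>2"

text \<open>Eliminating n from p = m + r n = m' + r' n gives (r' - r) p = r' m - r m'. The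
  expression is symmetric in the two spheres.\<close>

definition touch_point :: "osphere \<Rightarrow> osphere \<Rightarrow> point" where
  "touch_point s s' =
     (1 / (sradius s' - sradius s)) *\<^sub>R (sradius s' *\<^sub>R center s - sradius s *\<^sub>R center s')"

definition normal_at :: "osphere \<Rightarrow> point \<Rightarrow> point" where
  "normal_at s p = (1 / sradius s) *\<^sub>R (p - center s)"

lemma touching_commute: "touching s s' \<longleftrightarrow> touching s' s"
  by (auto simp: touching_def lor_simps power2_commute lor_commute)

lemma touching_normal:
  assumes "touching s s'"
  defines "n \<equiv> (1 / (sradius s' - sradius s)) *\<^sub>R (center s - center s')"
  shows "lor n n = 1" "normal_at s (touch_point s s') = n" "normal_at s' (touch_point s s') = n"
    "center s + sradius s *\<^sub>R n = touch_point s s'" "center s' + sradius s' *\<^sub>R n = touch_point s s'"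
proof -
  define a where "a = sradius s' - sradius s"
  have a: "a \<noteq> 0" "sradius s' = sradius s + a" using assms(1) by (auto simp: touching_def a_def)
  have "lor (center s - center s') (center s - center s') = a\<^sup>2"
    using assms(1) by (simp add: touching_def a_def power2_commute)
  then show "lor n n = 1"
    using a(1) unfolding n_def a_def[symmetric]
    by (simp add: lor_scaleR_left lor_scaleR_right power2_eq_square)
  have 1: "a *\<^sub>R touch_point s s' = sradius s' *\<^sub>R center s - sradius s *\<^sub>R center s'"
    using a(1) by (simp add: touch_point_def flip: a_def)
  have 2: "a *\<^sub>R n = center s - center s'" using a(1) by (simp add: n_def flip: a_def)
  have "a *\<^sub>R (center s + sradius s *\<^sub>R n) = a *\<^sub>R center s + sradius s *\<^sub>R (a *\<^sub>R n)"
    by (simp add: algebra_simps)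
  also have "\<dots> = a *\<^sub>R touch_point s s'" unfolding 1 2 a(2) by (simp add: algebra_simps)
  finally show 3: "center s + sradius s *\<^sub>R n = touch_point s s'" using a(1) by simp
  have "a *\<^sub>R (center s' + sradius s' *\<^sub>R n) = a *\<^sub>R center s' + sradius s' *\<^sub>R (a *\<^sub>R n)"
    by (simp add: algebra_simps)
  also have "\<dots> = a *\<^sub>R touch_point s s'" unfolding 1 2 a(2) by (simp add: algebra_simps)
  finally show 4: "center s' + sradius s' *\<^sub>R n = touch_point s s'" using a(1) by simp
  have "timelike s" "timelike s'" using assms(1) by (auto simp: touching_def)
  then have "sradius s \<noteq> 0" "sradius s' \<noteq> 0" using timelike_sradius(1) by blast+
  then show "normal_at s (touch_point s s') = n" "normal_at s' (touch_point s s') = n"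
    unfolding normal_at_def by (simp_all flip: 3) (simp add: 3 flip: 4)
qed

lemma touching_oriented_contact:
  assumes "touching s s'" shows "oriented_contact s s'"
  using touching_normal[OF assms] assms by (metis oriented_contact_iff touching_def)

lemma oriented_contact_touching:
  assumes "oriented_contact s s'" "s \<noteq> s'" shows "touching s s'"
proof -
  have t: "timelike s" "timelike s'" using assms(1) by (auto simp: oriented_contact_def)
  then obtain n where n: "lor n n = 1" "center s + sradius s *\<^sub>R n = center s' + sradius s' *\<^sub>R n"
    using assms(1) oriented_contact_iff by blast
  have d: "center s - center s' = (sradius s' - sradius s) *\<^sub>R n" using n(2) by (simp add: algebra_simps)
  have "sradius s \<noteq> sradius s'"
    using timelike_eqI[OF t] d assms(2) by auto
  moreover have "lor (center s - center s') (center s - center s') = (sradius s - sradius s')\<^sup>2"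
    unfolding d lor_scaleR_left lor_scaleR_right n(1) by (simp add: power2_eq_square algebra_simps)
  ultimately show ?thesis using t by (simp add: touching_def)
qed

lemma touch_point_mem_points:
  assumes "touching s s'"
  shows "touch_point s s' \<in> points s" "touch_point s s' \<in> points s'"
proof -
  have t: "timelike s" "timelike s'" using assms by (auto simp: touching_def)
  obtain n where n: "lor n n = 1" "touch_point s s' = center s + sradius s *\<^sub>R n"
    "touch_point s s' = center s' + sradius s' *\<^sub>R n"
    using touching_normal[OF assms] by metis
  show "touch_point s s' \<in> points s"
    unfolding timelike_sradius(4)[OF t(1)] n(2)
    using n(1) by (simp add: lor_scaleR_left lor_scaleR_right)
  show "touch_point s s' \<in> points s'"
    unfolding timelike_sradius(4)[OF t(2)] n(3)
    using n(1) by (simp add: lor_scaleR_left lor_scaleR_right)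
qed

text \<open>Lying on the spheres fixes a and b up to sign, and the squared distance of the centers
  gives a b = r r', so the signs agree. Thus a common point collinear with the centers is the
  oriented contact point, although no orientation is assumed at p.\<close>

lemma touch_point_unique:
  assumes "touching s s'" "p \<in> points s" "p \<in> points s'"
    and "center s = p + a *\<^sub>R n" "center s' = p + b *\<^sub>R n" "lor n n = 1"
  shows "p = touch_point s s'"
proof -
  define r r' where "r = sradius s" and "r' = sradius s'"
  have t: "timelike s" "timelike s'" and rr: "r' - r \<noteq> 0"
    using assms(1) by (auto simp: touching_def r_def r'_def)
  have r: "r \<noteq> 0" "r' \<noteq> 0" using t timelike_sradius by (auto simp: r_def r'_def)
  have a: "a * a = r * r" using assms(2,4,6) unfolding timelike_sradius(4)[OF t(1)]
    by (simp add: lor_simps r_def)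
  have b: "b * b = r' * r'" using assms(3,5,6) unfolding timelike_sradius(4)[OF t(2)]
    by (simp add: lor_simps r'_def)
  have "(a - b)\<^sup>2 = (r - r')\<^sup>2"
    using assms(1,6) unfolding touching_def assms(4,5)
    by (simp add: r_def r'_def power2_eq_square lor_simps algebra_simps)
  with a b have ab: "a * b = r * r'" by (simp add: power2_eq_square algebra_simps)
  have "a = r \<or> a = - r" using a by (simp add: square_eq_iff)
  with ab have "r' * a = r * b" by (elim disjE) (auto simp: mult.commute[of r' r])
  then have "r' *\<^sub>R center s - r *\<^sub>R center s' = (r' - r) *\<^sub>R p"
    by (simp add: assms(4,5) algebra_simps)
  then show ?thesis
    using rr by (simp add: touch_point_def flip: r_def r'_def)
qed

section \<open>Oriented isotropic lines in coordinates\<close>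

text \<open>The orientation is the component of the isotropic plane minus the line into which n points.\<close>

definition oline_of :: "point \<Rightarrow> point \<Rightarrow> point \<Rightarrow> oline" where
  "oline_of p d n = ({p + t *\<^sub>R d | t. True}, {p + t *\<^sub>R d + s *\<^sub>R n | t s. s > 0})"

definition null_frame :: "point \<Rightarrow> point \<Rightarrow> bool" where
  "null_frame d n \<longleftrightarrow> d \<noteq> 0 \<and> lor d d = 0 \<and> lor n n = 1 \<and> lor n d = 0"

text \<open>The line determines its base point and its unit vector n only up to multiples of d. This
  freedom later moves the base point to the contact point of two spheres and n to their common
  normal.\<close>

lemma oline_of_shift: "oline_of (p + a *\<^sub>R d) d (n + c *\<^sub>R d) = oline_of p d n"
proof -
  have *: "(\<exists>t. P (b + t)) \<longleftrightarrow> (\<exists>t. P t)" for P and b :: real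
    by (metis add_diff_cancel_left' diff_add_cancel add.commute)
  have "p + a *\<^sub>R d + t *\<^sub>R d = p + (a + t) *\<^sub>R d" for t
    by (simp add: algebra_simps)
  then have "{p + a *\<^sub>R d + t *\<^sub>R d | t. True} = {p + t *\<^sub>R d | t. True}"
    using *[of "\<lambda>t. x = p + t *\<^sub>R d" a for x] by (simp only: simp_thms)
  moreover have "p + a *\<^sub>R d + t *\<^sub>R d + s *\<^sub>R (n + c *\<^sub>R d) = p + (a + s * c + t) *\<^sub>R d + s *\<^sub>R n" for t s
    by (simp add: algebra_simps)
  then have "{p + a *\<^sub>R d + t *\<^sub>R d + s *\<^sub>R (n + c *\<^sub>R d) | t s. s > 0}
      = {p + t *\<^sub>R d + s *\<^sub>R n | t s. s > 0}"
    using *[of "\<lambda>t. x = p + t *\<^sub>R d + s *\<^sub>R n \<and> 0 < s" "a + s * c" for x s]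
    by (subst (1 2) ex_comm) (simp only: simp_thms)
  ultimately show ?thesis by (simp add: oline_of_def)
qed

lemma oline_of_scale:
  assumes "k \<noteq> 0" shows "oline_of p (k *\<^sub>R d) n = oline_of p d n"
proof -
  have *: "(\<exists>t. P (t * k)) \<longleftrightarrow> (\<exists>t. P t)" for P :: "real \<Rightarrow> bool"
    using assms by (metis nonzero_eq_divide_eq)
  have "{p + t *\<^sub>R k *\<^sub>R d | t. True} = {p + t *\<^sub>R d | t. True}"
    using *[of "\<lambda>t. x = p + t *\<^sub>R d" for x] by simp
  moreover have "{p + t *\<^sub>R k *\<^sub>R d + s *\<^sub>R n | t s. s > 0} = {p + t *\<^sub>R d + s *\<^sub>R n | t s. s > 0}"
    using *[of "\<lambda>t. \<exists>s. x = p + t *\<^sub>R d + s *\<^sub>R n \<and> 0 < s" for x] by simp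
  ultimately show ?thesis by (simp add: oline_of_def)
qed

text \<open>Removing the n-component of x leaves z orthogonal to d and n. Since
  \<open>lcross n d\<close> is d or -d, the triple product formula gives first
  \<open>lcross z d = 0\<close> and then that z is null, so z is a multiple of d.\<close>

lemma null_frame_plane:
  assumes "null_frame d n"
  shows "lor x d = 0 \<longleftrightarrow> (\<exists>t s. x = t *\<^sub>R d + s *\<^sub>R n)"
proof
  have dn: "d \<noteq> 0" "lor d d = 0" "lor n n = 1" "lor n d = 0"
    using assms by (auto simp: null_frame_def)
  assume x: "lor x d = 0"
  define z where "z = x - lor x n *\<^sub>R n"
  have z: "lor z d = 0" "lor z n = 0" using x dn by (simp_all add: z_def lor_simps)
  have "lcross z (lcross n d) = 0" by (simp add: lcross_lcross z)
  moreover have "lcross n d = d \<or> lcross n d = - d" by (rule null_imp_lcross_eigen[OF dn(3,4,2)])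
  ultimately have "lcross z d = 0" by (auto simp: lcross_def vec3_eq_iff)
  then have "lcross z (lcross z d) = 0" by (simp add: lcross_def vec3_eq_iff)
  then have "lor z z = 0" using dn(1) z by (simp add: lcross_lcross)
  then obtain k where "z = k *\<^sub>R d"
    using null_orthogonal_imp_parallel[OF dn(1,2)] z lor_commute by metis
  then have "x = k *\<^sub>R d + lor x n *\<^sub>R n" by (simp add: z_def algebra_simps)
  then show "\<exists>t s. x = t *\<^sub>R d + s *\<^sub>R n" by blast
qed (use assms in \<open>auto simp: null_frame_def lor_simps\<close>)

lemma null_frame_coord:
  assumes "null_frame d n"
  shows "lor (p + t *\<^sub>R d + s *\<^sub>R n - p) n = s"
  using assms by (simp add: null_frame_def lor_simps lor_commute[of d n])

lemma half_plane_component: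
  assumes dn: "null_frame d n"
  shows "snd (oline_of p d n) \<in> components ({x. lor (x - p) d = 0} - fst (oline_of p d n))"
proof -
  have mem: "x \<in> {x. lor (x - p) d = 0} - fst (oline_of p d n) \<longleftrightarrow>
    (\<exists>t s. x = p + t *\<^sub>R d + s *\<^sub>R n \<and> s \<noteq> 0)" for x
  proof
    assume x: "x \<in> {x. lor (x - p) d = 0} - fst (oline_of p d n)"
    then obtain t s where "x - p = t *\<^sub>R d + s *\<^sub>R n" using null_frame_plane[OF dn] by auto
    then have xe: "x = p + t *\<^sub>R d + s *\<^sub>R n" by (simp add: algebra_simps)
    moreover have "s \<noteq> 0" using x xe by (auto simp: oline_of_def)
    ultimately show "\<exists>t s. x = p + t *\<^sub>R d + s *\<^sub>R n \<and> s \<noteq> 0" by blast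
  next
    assume "\<exists>t s. x = p + t *\<^sub>R d + s *\<^sub>R n \<and> s \<noteq> 0"
    then obtain t s where x: "x = p + t *\<^sub>R d + s *\<^sub>R n" "s \<noteq> 0" by blast
    have "x \<noteq> p + t' *\<^sub>R d" for t'
      using null_frame_coord[OF dn, of p t s] null_frame_coord[OF dn, of p t' 0] x by auto
    then show "x \<in> {x. lor (x - p) d = 0} - fst (oline_of p d n)"
      using x(1) dn by (auto simp: oline_of_def null_frame_def lor_scaleR_left lor_add_left)
  qed
  let ?P = "snd (oline_of p d n)"
  have P: "x \<in> ?P \<longleftrightarrow> (\<exists>t s. x = p + t *\<^sub>R d + s *\<^sub>R n \<and> s > 0)" for x
    by (auto simp: oline_of_def)
  have "convex ?P"
  proof (rule convexI)
    fix x y and u v :: real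
    assume "x \<in> ?P" "y \<in> ?P" and uv: "0 \<le> u" "0 \<le> v" "u + v = 1"
    then obtain t s t' s' where xy: "x = p + t *\<^sub>R d + s *\<^sub>R n" "s > 0" "y = p + t' *\<^sub>R d + s' *\<^sub>R n" "s' > 0"
      unfolding P by blast
    have u: "u = 1 - v" using uv by simp
    have "u *\<^sub>R x + v *\<^sub>R y = p + (u * t + v * t') *\<^sub>R d + (u * s + v * s') *\<^sub>R n"
      unfolding xy u by (simp add: algebra_simps)
    moreover have "u * s + v * s' > 0"
      using uv xy by (cases "u = 0") (auto intro: add_pos_nonneg)
    ultimately show "u *\<^sub>R x + v *\<^sub>R y \<in> ?P" unfolding P by blast
  qed
  then have conn: "connected ?P" by (rule convex_connected)
  have "p + 0 *\<^sub>R d + 1 *\<^sub>R n \<in> ?P" unfolding P using zero_less_one by blast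
  then have ne: "p + n \<in> ?P" by simp
  have max: "D = ?P"
    if D: "?P \<subseteq> D" "D \<subseteq> {x. lor (x - p) d = 0} - fst (oline_of p d n)" "connected D" for D
  proof (rule ccontr)
    assume "D \<noteq> ?P"
    then obtain y where y: "y \<in> D" "y \<notin> ?P" using D(1) by blast
    then obtain t s where "y = p + t *\<^sub>R d + s *\<^sub>R n" "s \<noteq> 0" using mem D(2) by blast
    with y(2) have "s < 0" unfolding P by (metis linorder_neqE_linordered_idom)
    \<comment> \<open>The n-coordinate is continuous and vanishes nowhere off the line, so a
      connected set cannot contain points on both sides.\<close>
    define f where "f x = lor (x - p) n" for x
    have "continuous_on D f" unfolding f_def lor_def by (intro continuous_intros)
    then have "connected (f ` D)" using D(3) by (rule connected_continuous_image)
    moreover have "f y \<in> f ` D" "f (p + n) \<in> f ` D" using y ne D(1) by auto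
    moreover have "f y \<le> 0" "0 \<le> f (p + n)"
      using null_frame_coord[OF dn, of p t s] \<open>y = _\<close> \<open>s < 0\<close> null_frame_coord[OF dn, of p 0 1]
      by (auto simp: f_def)
    ultimately have "0 \<in> f ` D" by (metis connectedD_interval)
    then obtain z where z: "z \<in> D" "f z = 0" by auto
    then obtain t' s' where "z = p + t' *\<^sub>R d + s' *\<^sub>R n" "s' \<noteq> 0" using mem D(2) by blast
    with z(2) null_frame_coord[OF dn, of p t' s'] show False by (simp add: f_def)
  qed
  have "?P \<subseteq> {x. lor (x - p) d = 0} - fst (oline_of p d n)"
  proof
    fix x assume "x \<in> ?P"
    then have "\<exists>t s. x = p + t *\<^sub>R d + s *\<^sub>R n \<and> s \<noteq> 0" unfolding P by force
    then show "x \<in> {x. lor (x - p) d = 0} - fst (oline_of p d n)" unfolding mem .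
  qed
  then show ?thesis unfolding in_components_maximal using ne conn max by blast
qed

lemma null_frame_exists:
  assumes "d \<noteq> 0" "lor d d = 0" shows "\<exists>n. null_frame d n"
proof -
  have d: "(d $ 1) * (d $ 1) + (d $ 2) * (d $ 2) = (d $ 3) * (d $ 3)"
    using assms(2) by (simp add: lor_def)
  have d3: "d $ 3 \<noteq> 0"
  proof
    assume "d $ 3 = 0"
    with d have "d $ 1 = 0" "d $ 2 = 0" by auto
    with \<open>d $ 3 = 0\<close> \<open>d \<noteq> 0\<close> show False by (simp add: vec3_eq_iff)
  qed
  \<comment> \<open>The horizontal part of d turned by a right angle; its length is the absolute
    value of \<open>d $ 3\<close> because d is null.\<close>
  define n :: point where "n = vector [- (d $ 2 / d $ 3), d $ 1 / d $ 3, 0]"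
  have "lor n n = 1" using d3 d by (simp add: n_def lor_def field_simps)
  moreover have "lor n d = 0" by (simp add: n_def lor_def)
  ultimately show ?thesis using assms by (auto simp: null_frame_def)
qed

text \<open>The two components are the half-planes into which n and -n point. A single point x of
  the given component tells which of them it is.\<close>

lemma oriented_isotropic_line_iff:
  "oriented_isotropic_line lo \<longleftrightarrow> (\<exists>p d n. null_frame d n \<and> lo = oline_of p d n)"
proof
  assume "oriented_isotropic_line lo"
  then obtain p d where pd: "d \<noteq> 0" "lor d d = 0" "fst lo = {p + t *\<^sub>R d | t. True}"
    "snd lo \<in> components ({x. lor (x - p) d = 0} - fst lo)"
    by (auto simp: oriented_isotropic_line_def split: prod.splits)
  obtain n where n: "null_frame d n" using null_frame_exists pd by blast
  then have n': "null_frame d (- n)" by (simp add: null_frame_def lor_simps)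
  have L: "fst lo = fst (oline_of p d n)" "fst lo = fst (oline_of p d (- n))"
    using pd by (auto simp: oline_of_def)
  obtain x where x: "x \<in> snd lo" using in_components_nonempty[OF pd(4)] by blast
  then have "x \<in> {x. lor (x - p) d = 0} - fst lo" using in_components_subset[OF pd(4)] by blast
  then obtain t s where "x - p = t *\<^sub>R d + s *\<^sub>R n" and xL: "x \<notin> fst lo"
    using null_frame_plane[OF n] by auto
  then have xe: "x = p + t *\<^sub>R d + s *\<^sub>R n" by (simp add: algebra_simps)
  with xL pd(3) have "s \<noteq> 0" by auto
  have "x \<in> snd (oline_of p d n) \<or> x \<in> snd (oline_of p d (- n))"
  proof (cases "s > 0")
    case True
    then show ?thesis using xe by (auto simp: oline_of_def)
  next
    case False
    have "x = p + t *\<^sub>R d + (- s) *\<^sub>R (- n) \<and> - s > 0" using xe False \<open>s \<noteq> 0\<close> by simp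
    then show ?thesis unfolding oline_of_def snd_conv by blast
  qed
  moreover have "\<Omega> = snd lo" if "x \<in> \<Omega>" "\<Omega> \<in> components ({x. lor (x - p) d = 0} - fst lo)" for \<Omega>
    using components_eq[OF that(2) pd(4)] x that(1) by blast
  ultimately have "snd lo = snd (oline_of p d n) \<or> snd lo = snd (oline_of p d (- n))"
    using half_plane_component[OF n, of p] half_plane_component[OF n', of p] L by metis
  then show "\<exists>p d n. null_frame d n \<and> lo = oline_of p d n"
    using n n' L by (metis prod.collapse)
next
  assume "\<exists>p d n. null_frame d n \<and> lo = oline_of p d n"
  then obtain p d n where *: "null_frame d n" "lo = oline_of p d n" by blast
  then show "oriented_isotropic_line lo"
    using half_plane_component[OF *(1), of p]
    unfolding oriented_isotropic_line_def null_frame_def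
    by (auto simp: oline_of_def)
qed

text \<open>Containing the line puts the center at p + t d + a n with a equal to r or -r. The
  orientation condition selects -r in both cases, because r carries the sign of the
  orientation.\<close>

lemma contact_line_timelike:
  assumes "timelike s" "null_frame d n"
  shows "contact_line s (oline_of p d n) \<longleftrightarrow> (\<exists>t. center s = p + t *\<^sub>R d - sradius s *\<^sub>R n)"
proof -
  obtain m \<rho> e where s: "s = Timelike m \<rho> e" using assms(1) by (auto simp: timelike_def)
  define r where "r = sradius s"
  have r: "r \<noteq> 0" "\<rho> = r * r" "e = Outwards \<longleftrightarrow> r > 0"
    using timelike_sradius[OF assms(1)] by (auto simp: s r_def)
  have dn: "lor d d = 0" "lor n n = 1" "lor n d = 0" "lor d n = 0"
    using assms(2) by (auto simp: null_frame_def lor_commute)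
  have "contact_line s (oline_of p d n) \<longleftrightarrow>
    (\<forall>t. lor (p + t *\<^sub>R d - m) (p + t *\<^sub>R d - m) = r * r) \<and>
    (if r > 0 then m \<notin> snd (oline_of p d n) else m \<in> snd (oline_of p d n))"
    using r by (cases e) (auto simp: s oline_of_def lsphere_def)
  also have "\<dots> \<longleftrightarrow> (\<exists>t. m = p + t *\<^sub>R d - r *\<^sub>R n)"
  proof
    assume *: "(\<forall>t. lor (p + t *\<^sub>R d - m) (p + t *\<^sub>R d - m) = r * r) \<and>
      (if r > 0 then m \<notin> snd (oline_of p d n) else m \<in> snd (oline_of p d n))"
    \<comment> \<open>Two points of the line suffice to force the center into the isotropic
      plane.\<close>
    then have "lor (p + 0 *\<^sub>R d - m) (p + 0 *\<^sub>R d - m) = r * r"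
      "lor (p + 1 *\<^sub>R d - m) (p + 1 *\<^sub>R d - m) = r * r" by blast+
    then have pm: "lor (p - m) (p - m) = r * r" "lor (p + d - m) (p + d - m) = r * r" by simp_all
    moreover have "lor (p + d - m) (p + d - m) = lor (p - m) (p - m) - 2 * lor (m - p) d + lor d d"
      by (simp add: lor_def algebra_simps)
    ultimately have "lor (m - p) d = 0" using dn by simp
    then obtain t a where "m - p = t *\<^sub>R d + a *\<^sub>R n" using null_frame_plane[OF assms(2)] by blast
    then have m: "m = p + t *\<^sub>R d + a *\<^sub>R n" by (simp add: algebra_simps)
    have "a * a = r * r" using pm(1) dn unfolding m by (simp add: lor_simps)
    then have ar: "a = r \<or> a = - r" by (simp add: square_eq_iff)
    have "m \<in> snd (oline_of p d n) \<longleftrightarrow> a > 0"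
    proof
      assume "m \<in> snd (oline_of p d n)"
      then obtain t' a' where "m = p + t' *\<^sub>R d + a' *\<^sub>R n" "a' > 0" by (auto simp: oline_of_def)
      then show "a > 0" using null_frame_coord[OF assms(2)] m by metis
    qed (auto simp: oline_of_def m)
    then have "a = - r" using * ar r(1) by (auto split: if_splits)
    then show "\<exists>t. m = p + t *\<^sub>R d - r *\<^sub>R n" using m by auto
  next
    assume "\<exists>t. m = p + t *\<^sub>R d - r *\<^sub>R n"
    then obtain t where m: "m = p + t *\<^sub>R d + (- r) *\<^sub>R n" by auto
    have "p + t' *\<^sub>R d - m = (t' - t) *\<^sub>R d + r *\<^sub>R n" for t'
      unfolding m by (simp add: algebra_simps)
    then have "\<forall>t'. lor (p + t' *\<^sub>R d - m) (p + t' *\<^sub>R d - m) = r * r"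
      using dn by (simp add: lor_add_left lor_add_right lor_scaleR_left lor_scaleR_right)
    moreover have "m \<notin> snd (oline_of p d n)" if "r > 0"
    proof
      assume "m \<in> snd (oline_of p d n)"
      then obtain t' a' where "m = p + t' *\<^sub>R d + a' *\<^sub>R n" "a' > 0" by (auto simp: oline_of_def)
      then have "- r > 0" using null_frame_coord[OF assms(2)] m by metis
      with that show False by simp
    qed
    moreover have "m \<in> snd (oline_of p d n)" if "\<not> r > 0"
    proof -
      have "- r > 0" using that r(1) by simp
      with m show ?thesis unfolding oline_of_def snd_conv by blast
    qed
    ultimately show "(\<forall>t. lor (p + t *\<^sub>R d - m) (p + t *\<^sub>R d - m) = r * r) \<and>
      (if r > 0 then m \<notin> snd (oline_of p d n) else m \<in> snd (oline_of p d n))" by simp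
  qed
  finally show ?thesis unfolding r_def s by simp
qed

lemma contact_line_Null: "contact_line (Null m) (oline_of p d n) \<longleftrightarrow> (\<exists>t. m = p + t *\<^sub>R d)"
  by (simp add: oline_of_def)

text \<open>Both centers lie in the isotropic plane of the line, where the squared length of a
  vector depends only on its n-coordinate.\<close>

lemma contact_line_sradius_diff:
  assumes "oriented_isotropic_line lo" "timelike s" "timelike s'"
    "contact_line s lo" "contact_line s' lo"
  shows "lor (center s - center s') (center s - center s') = (sradius s - sradius s')\<^sup>2"
proof -
  obtain p d n where dn: "null_frame d n" "lo = oline_of p d n"
    using assms(1) oriented_isotropic_line_iff by blast
  then obtain t t' where t: "center s = p + t *\<^sub>R d - sradius s *\<^sub>R n"
    "center s' = p + t' *\<^sub>R d - sradius s' *\<^sub>R n"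
    using assms contact_line_timelike by metis
  have "center s - center s' = (t - t') *\<^sub>R d + (sradius s' - sradius s) *\<^sub>R n"
    unfolding t by (simp add: algebra_simps)
  moreover have "lor (t *\<^sub>R d + a *\<^sub>R n) (t *\<^sub>R d + a *\<^sub>R n) = a\<^sup>2" for t a
    using dn(1) by (simp add: null_frame_def lor_add_left lor_add_right lor_scaleR_left
      lor_scaleR_right lor_commute[of d n] power2_eq_square)
  ultimately show ?thesis by (simp add: power2_commute)
qed

lemma contact_line_touching:
  assumes "oriented_isotropic_line lo" "touching s s'" "contact_line s lo" "contact_line s' lo"
  defines "p \<equiv> touch_point s s'"
  shows "\<exists>d. null_frame d (normal_at s p) \<and> lo = oline_of p d (normal_at s p)"
proof -
  have t: "timelike s" "timelike s'" using assms(2) by (auto simp: touching_def)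
  obtain q d n where dn: "null_frame d n" "lo = oline_of q d n"
    using assms(1) oriented_isotropic_line_iff by blast
  then obtain t t' where t: "center s = q + t *\<^sub>R d - sradius s *\<^sub>R n"
    "center s' = q + t' *\<^sub>R d - sradius s' *\<^sub>R n"
    using assms t contact_line_timelike by metis
  define a where "a = sradius s' - sradius s"
  have a: "a \<noteq> 0" using assms(2) by (simp add: touching_def a_def)
  note N = touching_normal[OF assms(2), folded p_def a_def]
  \<comment> \<open>The difference of the centers is (t - t') d + a n; dividing by a shows by which
    multiple of d the common normal differs from n.\<close>
  define c where "c = (t - t') / a"
  have "center s - center s' = (t - t') *\<^sub>R d + a *\<^sub>R n"
    unfolding t a_def by (simp add: algebra_simps)
  then have n: "normal_at s p = n + c *\<^sub>R d" unfolding N(2) using a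
    by (simp add: scaleR_add_right c_def)
  have "p = center s + sradius s *\<^sub>R normal_at s p" using N(2,4) by simp
  then have "p = q + (t + sradius s * c) *\<^sub>R d"
    unfolding n t by (simp add: algebra_simps)
  then have "lo = oline_of p d (normal_at s p)" using dn(2) n oline_of_shift by metis
  moreover have "null_frame d (normal_at s p)"
    using dn(1) unfolding n null_frame_def by (simp add: lor_simps lor_commute[of d n])
  ultimately show ?thesis by blast
qed

section \<open>The S-isothermic net of an isothermic congruence\<close>

definition first_white :: "face \<Rightarrow> vertex" where
  "first_white = (\<lambda>(i, j). if even (i + j) then (i + 1, j) else (i, j))"

definition second_white :: "face \<Rightarrow> vertex" where
  "second_white = (\<lambda>(i, j). if even (i + j) then (i, j + 1) else (i + 1, j + 1))"

lemma white_iff_not_black: "v \<in> white \<longleftrightarrow> v \<notin> black"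
  by (cases v) (auto simp: white_def black_def)

lemma face_whites: "face_vertices f \<inter> white = {first_white f, second_white f}"
  by (cases f) (auto simp: face_vertices_def white_def first_white_def second_white_def)

lemma first_white_neq_second_white: "first_white f \<noteq> second_white f"
  by (cases f) (auto simp: first_white_def second_white_def)

lemma face_has_black: "\<exists>b. b \<in> face_vertices f \<and> b \<in> black"
proof -
  obtain i j where f: "f = (i, j)" by fastforce
  have "(i, j) \<in> black \<or> (i + 1, j) \<in> black" by (auto simp: black_def)
  then show ?thesis by (auto simp: f face_vertices_def)
qed

text \<open>Vertices and faces share a type, so a vertex b also names the face with lower left
  corner b. This face serves as a standard choice among the four around b, as in \<open>hF b\<close>
  or \<open>first_white b\<close>.\<close>

lemma face_at_vertex: "v \<in> face_vertices v"
  by (cases v) (auto simp: face_vertices_def)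

lemma face_white_neighbour:
  assumes "b \<in> face_vertices f" "b \<in> black" "w \<in> face_vertices f" "w \<in> white"
  shows "w \<in> neighbours b"
  using assms by (cases f) (auto simp: face_vertices_def white_def black_def neighbours_def)

lemma neighbour_face:
  assumes "b \<in> black" "w \<in> neighbours b"
  shows "w \<in> white" "\<exists>f. b \<in> face_vertices f \<and> w \<in> face_vertices f"
proof -
  obtain i j where b: "b = (i, j)" by fastforce
  show "w \<in> white" using assms by (auto simp: b white_def black_def neighbours_def)
  have "w \<in> face_vertices (i, j) \<or> w \<in> face_vertices (i - 1, j - 1)"
    using assms by (auto simp: b neighbours_def face_vertices_def)
  moreover have "b \<in> face_vertices (i, j)" "b \<in> face_vertices (i - 1, j - 1)"
    by (auto simp: b face_vertices_def)
  ultimately show "\<exists>f. b \<in> face_vertices f \<and> w \<in> face_vertices f" by blast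
qed

text \<open>Consecutive white neighbours of b lie on a common face, so equality on faces spreads
  around b.\<close>

lemma constant_on_neighbours:
  assumes "\<And>f w w'. b \<in> face_vertices f \<Longrightarrow> w \<in> face_vertices f \<Longrightarrow> w' \<in> face_vertices f \<Longrightarrow>
      w \<in> neighbours b \<Longrightarrow> w' \<in> neighbours b \<Longrightarrow> g w = g w'"
    and "w \<in> neighbours b" "w' \<in> neighbours b"
  shows "g w = g w'"
proof -
  obtain i j where b: "b = (i, j)" by fastforce
  have "g (i + 1, j) = g (i, j + 1)"
    by (rule assms(1)[of "(i, j)"]) (auto simp: b face_vertices_def neighbours_def)
  moreover have "g (i - 1, j) = g (i, j + 1)"
    by (rule assms(1)[of "(i - 1, j)"]) (auto simp: b face_vertices_def neighbours_def)
  moreover have "g (i - 1, j) = g (i, j - 1)"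
    by (rule assms(1)[of "(i - 1, j - 1)"]) (auto simp: b face_vertices_def neighbours_def)
  ultimately show ?thesis using assms(2,3) by (auto simp: b neighbours_def)
qed

text \<open>The two ends of the common edge have different colours.\<close>

lemma neighbour_faces_share:
  assumes "f' \<in> neighbours f"
  shows "\<exists>b w. b \<in> black \<and> w \<in> white \<and> b \<in> face_vertices f \<and> b \<in> face_vertices f' \<and>
    w \<in> face_vertices f \<and> w \<in> face_vertices f'"
proof -
  obtain i j where f: "f = (i, j)" by fastforce
  have *: ?thesis if "u \<in> face_vertices f" "u \<in> face_vertices f'" "v \<in> face_vertices f"
    "v \<in> face_vertices f'" "u \<in> black \<longleftrightarrow> v \<in> white" for u v
    using that white_iff_not_black by metis
  from assms have "f' = (i + 1, j) \<or> f' = (i, j + 1) \<or> f' = (i - 1, j) \<or> f' = (i, j - 1)"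
    by (simp add: f neighbours_def)
  then show ?thesis
  proof (elim disjE)
    assume "f' = (i + 1, j)"
    then show ?thesis
      by (intro *[of "(i + 1, j)" "(i + 1, j + 1)"]) (auto simp: f face_vertices_def black_def white_def)
  next
    assume "f' = (i, j + 1)"
    then show ?thesis
      by (intro *[of "(i, j + 1)" "(i + 1, j + 1)"]) (auto simp: f face_vertices_def black_def white_def)
  next
    assume "f' = (i - 1, j)"
    then show ?thesis
      by (intro *[of "(i, j)" "(i, j + 1)"]) (auto simp: f face_vertices_def black_def white_def)
  next
    assume "f' = (i, j - 1)"
    then show ?thesis
      by (intro *[of "(i, j)" "(i + 1, j)"]) (auto simp: f face_vertices_def black_def white_def)
  qed
qed

lemma neighbours_connected:
  assumes "\<And>f f' :: face. f' \<in> neighbours f \<Longrightarrow> \<tau> f' = \<tau> f"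
  shows "\<tau> f = \<tau> (0, 0)"
proof -
  have "\<tau> (i, j) = \<tau> (0, j)" for i j
  proof (induction i rule: int_induct[where k = 0])
    case (step1 i)
    then show ?case using assms[of "(i + 1, j)" "(i, j)"] by (simp add: neighbours_def)
  next
    case (step2 i)
    then show ?case using assms[of "(i - 1, j)" "(i, j)"] by (simp add: neighbours_def)
  qed simp
  moreover have "\<tau> (0, j) = \<tau> (0, 0)" for j
  proof (induction j rule: int_induct[where k = 0])
    case (step1 j)
    then show ?case using assms[of "(0, j + 1)" "(0, j)"] by (simp add: neighbours_def)
  next
    case (step2 j)
    then show ?case using assms[of "(0, j - 1)" "(0, j)"] by (simp add: neighbours_def)
  qed simp
  ultimately show ?thesis by (cases f) metis
qed

lemma collinear_if_orthogonal:
  assumes "spacelike_plane E" "S \<subseteq> E" "q \<in> E" "q' \<in> E" "q \<noteq> q'"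
    and "\<And>x y. x \<in> S \<Longrightarrow> y \<in> S \<Longrightarrow> lor (x - y) (q - q') = 0"
  shows "collinear S"
proof -
  define R where "R = lor (q - q') (q - q')"
  have R: "R > 0" using assms by (auto simp: R_def spacelike_plane_def)
  \<comment> \<open>An auxiliary circle about q' through q: it supplies a frame of E with one axis
    along q - q'.\<close>
  have "proper_circle {x \<in> E. lor (x - q') (x - q') = R} E q' R" using assms R by (simp add: proper_circle_def)
  moreover have "q \<in> {x \<in> E. lor (x - q') (x - q') = R}" using assms by (simp add: R_def)
  ultimately obtain n where n: "lor n (q - q') = 0"
    "\<And>x. x \<in> E \<longleftrightarrow> (\<exists>s t. x = q + s *\<^sub>R n + t *\<^sub>R (q - q'))"
    using proper_circle_frame by blast
  have "\<exists>c. x - y = c *\<^sub>R n" if xy: "x \<in> S" "y \<in> S" for x y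
  proof -
    obtain s t s' t' where st: "x = q + s *\<^sub>R n + t *\<^sub>R (q - q')" "y = q + s' *\<^sub>R n + t' *\<^sub>R (q - q')"
      using n(2) xy assms(2) by blast
    have d: "x - y = (s - s') *\<^sub>R n + (t - t') *\<^sub>R (q - q')" unfolding st by (simp add: algebra_simps)
    have "(t - t') * R = 0"
      using assms(6)[OF xy] n(1) unfolding d R_def by (simp add: lor_add_left lor_scaleR_left)
    then show ?thesis using d R by auto
  qed
  then show ?thesis unfolding collinear_def by blast
qed

lemma spacelike_planes_eq:
  assumes "spacelike_plane E" "spacelike_plane E'" "S \<subseteq> E" "S \<subseteq> E'" "\<not> collinear S"
  shows "E = E'"
proof -
  have *: "affine hull S = E" if E: "spacelike_plane E" "S \<subseteq> E" for E
  proof (rule affine_dim_equal)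
    show "affine (affine hull S)" "affine E" "affine hull S \<noteq> {}"
      using E assms(5) by (auto simp: spacelike_plane_def plane_def)
    show "affine hull S \<subseteq> E"
      using E by (auto simp: spacelike_plane_def plane_def intro: hull_minimal[THEN subsetD])
    then have "aff_dim S \<le> 2" using E aff_dim_subset[of S E] by (simp add: spacelike_plane_def plane_def)
    moreover have "aff_dim S > 1" using assms(5) by (simp add: collinear_aff_dim)
    ultimately show "aff_dim (affine hull S) = aff_dim E"
      using E by (simp add: spacelike_plane_def plane_def)
  qed
  show ?thesis using *[OF assms(1,3)] *[OF assms(2,4)] by simp
qed

section \<open>Contact points, normals and uniqueness of an S-isothermic net\<close>

locale S_net =
  fixes hw :: "vertex \<Rightarrow> osphere" and hb :: "vertex \<Rightarrow> point set" and hF :: "face \<Rightarrow> point"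
  assumes net: "S_isothermic_net hw hb hF" and distinct: "distinct_spheres hw"
begin

lemma white_timelike: "w \<in> white \<Longrightarrow> timelike (hw w)"
  using net by (simp add: S_isothermic_net_def)

lemma face_touching: "touching (hw (first_white f)) (hw (second_white f))"
proof (rule oriented_contact_touching)
  have w: "first_white f \<in> face_vertices f \<inter> white" "second_white f \<in> face_vertices f \<inter> white"
    by (simp_all add: face_whites)
  then show "oriented_contact (hw (first_white f)) (hw (second_white f))"
    using net first_white_neq_second_white[of f] unfolding S_isothermic_net_def by blast
  show "hw (first_white f) \<noteq> hw (second_white f)"
    using distinct w first_white_neq_second_white[of f] unfolding distinct_spheres_def inj_on_def by blast
qed

lemma meets:
  assumes "b \<in> face_vertices f" "b \<in> black" "w \<in> face_vertices f" "w \<in> white"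
  shows "meets_orthogonally (hb b) (hw w) (hF f)"
proof -
  have "\<forall>b\<in>face_vertices f \<inter> black. \<forall>w\<in>face_vertices f \<inter> white. meets_orthogonally (hb b) (hw w) (hF f)"
    using net[unfolded S_isothermic_net_def, THEN conjunct2, THEN conjunct2, THEN conjunct2,
        THEN conjunct2, THEN spec, of f] by (rule conjunct2)
  with assms show ?thesis by blast
qed

text \<open>An orthogonal intersection provides a tangent line, which a one-point circle does not
  have.\<close>

lemma black_circle:
  assumes "b \<in> black" shows "\<exists>E q R. proper_circle (hb b) E q R"
proof -
  have "first_white b \<in> face_vertices b" "first_white b \<in> white" using face_whites[of b] by auto
  from meets[OF face_at_vertex assms this] circle_tangent_lineD show ?thesis
    unfolding meets_orthogonally_def by blast
qed

lemma proper_circle_meets: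
  assumes "proper_circle (hb b) E q R" "b \<in> face_vertices f" "b \<in> black" "w \<in> face_vertices f" "w \<in> white"
  shows "hF f \<in> hb b" "hF f \<in> points (hw w)" "center (hw w) \<in> E"
    "lor (center (hw w) - hF f) (hF f - q) = 0"
  using meets[OF assms(2-5)] meets_orthogonally_proper_circle[OF assms(1) white_timelike[OF assms(5)]] by auto

text \<open>By orthogonality both white centers lie on the tangent line of the circle at
  \<open>hF f\<close>, so the point is determined by the white spheres alone.\<close>

lemma contact_point: "hF f = touch_point (hw (first_white f)) (hw (second_white f))"
proof -
  obtain b where b: "b \<in> face_vertices f" "b \<in> black" using face_has_black by blast
  obtain E q R where C: "proper_circle (hb b) E q R" using black_circle[OF b(2)] by blast
  have w: "first_white f \<in> face_vertices f" "first_white f \<in> white"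
    "second_white f \<in> face_vertices f" "second_white f \<in> white"
    using face_whites[of f] by auto
  note m = proper_circle_meets[OF C b w(1,2)] proper_circle_meets[OF C b w(3,4)]
  obtain n where n: "lor n n = 1"
    "{x \<in> E. lor (x - hF f) (hF f - q) = 0} = {hF f + s *\<^sub>R n | s. True}"
    using proper_circle_tangent_line[OF C m(1)] by blast
  have "center (hw (first_white f)) \<in> {x \<in> E. lor (x - hF f) (hF f - q) = 0}"
    "center (hw (second_white f)) \<in> {x \<in> E. lor (x - hF f) (hF f - q) = 0}"
    using m by auto
  then obtain s t where "center (hw (first_white f)) = hF f + s *\<^sub>R n"
    "center (hw (second_white f)) = hF f + t *\<^sub>R n"
    unfolding n(2) by blast
  with touch_point_unique[OF face_touching m(2,6) _ _ n(1)] show ?thesis by blast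
qed

text \<open>The second white sphere has the same normal at this point, so the choice of the first is
  immaterial.\<close>

definition fnormal :: "face \<Rightarrow> point" where
  "fnormal f = normal_at (hw (first_white f)) (hF f)"

lemma fnormal_unit: "lor (fnormal f) (fnormal f) = 1"
  using touching_normal(1,2)[OF face_touching] by (simp add: fnormal_def contact_point)

lemma fnormal:
  assumes "w \<in> face_vertices f" "w \<in> white"
  shows "hF f = center (hw w) + sradius (hw w) *\<^sub>R fnormal f"
proof -
  have "w = first_white f \<or> w = second_white f" using assms face_whites[of f] by auto
  then show ?thesis
    using touching_normal(2,4,5)[OF face_touching[of f]] by (auto simp: fnormal_def contact_point)
qed

lemma fnormal_orthogonal:
  assumes "proper_circle (hb b) E q R" "b \<in> face_vertices f" "b \<in> black"
  shows "lor (fnormal f) (hF f - q) = 0"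
proof -
  have w: "first_white f \<in> face_vertices f" "first_white f \<in> white"
    using face_whites[of f] by auto
  have "center (hw (first_white f)) - hF f = (- sradius (hw (first_white f))) *\<^sub>R fnormal f"
    using fnormal[OF w] by simp
  then have "sradius (hw (first_white f)) * lor (fnormal f) (hF f - q) = 0"
    using proper_circle_meets(4)[OF assms w] by (simp add: lor_minus_left lor_scaleR_left)
  then show ?thesis using timelike_sradius(1)[OF white_timelike[OF w(2)]] by simp
qed

end

lemma S_net_unique:
  assumes "S_net hw hb hF" "S_net hw hb' hF'" "noncollinear_centers hw"
  shows "hb = hb'" "hF = hF'"
proof -
  interpret A: S_net hw hb hF by fact
  interpret B: S_net hw hb' hF' by fact
  show F: "hF = hF'" using A.contact_point B.contact_point by auto
  have "hb b = hb' b" if b: "b \<in> black" for b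
  proof -
    obtain E q R where C: "proper_circle (hb b) E q R" using A.black_circle[OF b] by blast
    obtain E' q' R' where C': "proper_circle (hb' b) E' q' R'" using B.black_circle[OF b] by blast
    let ?S = "(\<lambda>w. center (hw w)) ` neighbours b"
    have S: "\<not> collinear ?S" using assms(3) b by (simp add: noncollinear_centers_def)
    have SE: "?S \<subseteq> E" "?S \<subseteq> E'"
      using neighbour_face[OF b] A.proper_circle_meets(3)[OF C _ b] B.proper_circle_meets(3)[OF C' _ b] by blast+
    have E: "spacelike_plane E" "spacelike_plane E'" "q \<in> E" "q' \<in> E'"
      using C C' by (auto simp: proper_circle_def)
    have EE: "E = E'" by (rule spacelike_planes_eq[OF E(1,2) SE S])
    have qq: "q = q'"
    proof (rule ccontr)
      assume ne: "q \<noteq> q'"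
      \<comment> \<open>At each face the tangent line is orthogonal to the radii from both q and q',
        hence to q - q'. Passing from face to face around b, all four white centers have the same
        product with q - q', which makes them collinear.\<close>
      have "lor (center (hw w)) (q - q') = lor (center (hw w')) (q - q')"
        if w: "w \<in> neighbours b" "w' \<in> neighbours b" for w w'
      proof (rule constant_on_neighbours[where b = b])
        fix f w w' assume f: "b \<in> face_vertices f" "w \<in> face_vertices f" "w' \<in> face_vertices f"
          "w \<in> neighbours b" "w' \<in> neighbours b"
        have "lor (center (hw v)) (q - q') = lor (hF f) (q - q')"
          if v: "v \<in> face_vertices f" "v \<in> neighbours b" for v
        proof -
          have vw: "v \<in> white" using neighbour_face(1)[OF b v(2)] .
          have "lor (center (hw v) - hF f) (hF f - q) = 0" "lor (center (hw v) - hF f) (hF f - q') = 0"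
            using A.proper_circle_meets(4)[OF C f(1) b v(1) vw] B.proper_circle_meets(4)[OF C' f(1) b v(1) vw]
            by (simp_all add: F)
          then show ?thesis by (simp add: lor_diff_left lor_diff_right)
        qed
        then show "lor (center (hw w)) (q - q') = lor (center (hw w')) (q - q')" using f by metis
      qed (use w in auto)
      then have "collinear ?S"
        by (intro collinear_if_orthogonal[OF E(1) SE(1) E(3) E(4)[folded EE] ne])
          (auto simp: lor_diff_left)
      with S show False by contradiction
    qed
    have w: "first_white b \<in> face_vertices b" "first_white b \<in> white" using face_whites[of b] by auto
    have "hF b \<in> hb b" "hF b \<in> hb' b"
      using A.proper_circle_meets(1)[OF C face_at_vertex b w] B.proper_circle_meets(1)[OF C' face_at_vertex b w]
      by (simp_all add: F)
    with C C' EE qq show ?thesis by (auto simp: proper_circle_def)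
  qed
  moreover have "hb \<in> extensional black" "hb' \<in> extensional black"
    using A.net B.net by (simp_all add: S_isothermic_net_def)
  ultimately show "hb = hb'" by (intro extensionalityI) auto
qed

text \<open>The circle at b is cut out of the null-sphere \<open>c b\<close> by the plane E of the
  white centers. The work lies in showing that this section has positive radius.\<close>

lemma S_net_restrict:
  assumes "isothermic_congruence c cF" "distinct_spheres c" "noncollinear_centers c"
  shows "\<exists>hb hF. S_isothermic_net (restrict c white) hb hF"
proof -
  have iso: "\<And>v. null_sphere (c v) \<or> timelike (c v)" "\<And>f. oriented_isotropic_line (cF f)"
    "\<And>f v. v \<in> face_vertices f \<Longrightarrow> contact_line (c v) (cF f)"
    "\<And>b. b \<in> black \<Longrightarrow> null_sphere (c b)" "\<And>w. w \<in> white \<Longrightarrow> timelike (c w)"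
    "\<And>b. b \<in> black \<Longrightarrow> \<exists>E. spacelike_plane E \<and> (\<forall>w\<in>neighbours b. center (c w) \<in> E)"
    using assms(1)
    by (auto simp: isothermic_congruence_def null_congruence_def contact_congruence_def)
  define hF where "hF f = touch_point (c (first_white f)) (c (second_white f))" for f
  have wh: "first_white f \<in> face_vertices f" "first_white f \<in> white"
    "second_white f \<in> face_vertices f" "second_white f \<in> white" for f
    using face_whites[of f] by auto
  have touch: "touching (c (first_white f)) (c (second_white f))" for f
  proof -
    obtain b where b: "b \<in> face_vertices f" "b \<in> black" using face_has_black by blast
    obtain E where E: "spacelike_plane E" "\<forall>w\<in>neighbours b. center (c w) \<in> E" using iso(6) b by blast
    have t: "timelike (c (first_white f))" "timelike (c (second_white f))" using iso(5) wh by auto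
    have m: "center (c (first_white f)) \<in> E" "center (c (second_white f)) \<in> E"
      using E(2) face_white_neighbour[OF b] wh by auto
    have l: "lor (center (c (first_white f)) - center (c (second_white f)))
        (center (c (first_white f)) - center (c (second_white f)))
        = (sradius (c (first_white f)) - sradius (c (second_white f)))\<^sup>2"
      by (rule contact_line_sradius_diff[OF iso(2) t iso(3)[OF wh(1)] iso(3)[OF wh(3)]])
    have "c (first_white f) \<noteq> c (second_white f)"
      using assms(2) wh[of f] first_white_neq_second_white[of f]
      unfolding distinct_spheres_def inj_on_def by blast
    \<comment> \<open>For equal radii the centers would differ by a null vector; inside the
      spacelike plane they would be equal, and so would the spheres.\<close>
    then have "sradius (c (first_white f)) \<noteq> sradius (c (second_white f))"
      using spacelike_plane_null_diff[OF E(1) m] l timelike_eqI[OF t] by auto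
    with t l show ?thesis by (simp add: touching_def)
  qed
  have circ: "\<exists>C. spacelike_circle C \<and> (\<forall>f w. b \<in> face_vertices f \<longrightarrow> w \<in> face_vertices f \<longrightarrow>
      w \<in> white \<longrightarrow> meets_orthogonally C (c w) (hF f))" if b: "b \<in> black" for b
  proof -
    obtain E where E: "spacelike_plane E" "\<And>w. w \<in> neighbours b \<Longrightarrow> center (c w) \<in> E"
      using iso(6) b by blast
    obtain M where M: "c b = Null M" using iso(4)[OF b] by (auto simp: null_sphere_def)
    have face: "hF f \<in> points (c w)" "lor (hF f - M) (hF f - M) = 0"
        "lor (center (c w) - hF f) (hF f - M) = 0" "hF f \<in> E"
        "\<exists>n. \<forall>v\<in>face_vertices f \<inter> white. \<exists>k. k \<noteq> 0 \<and> center (c v) - hF f = k *\<^sub>R n"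
      if f: "b \<in> face_vertices f" "w \<in> face_vertices f" "w \<in> white" for f w
    proof -
      define n where "n = normal_at (c (first_white f)) (hF f)"
      note N = touching_normal[OF touch[of f], folded hF_def]
      obtain d where d: "null_frame d n" "cF f = oline_of (hF f) d n"
        using contact_line_touching[OF iso(2) touch iso(3)[OF wh(1)] iso(3)[OF wh(3)], of f]
        by (auto simp: n_def hF_def)
      have "contact_line (Null M) (oline_of (hF f) d n)" using iso(3)[OF f(1)] d(2) M by simp
      then obtain t where t: "M = hF f + t *\<^sub>R d" using contact_line_Null by blast
      have cn: "center (c v) - hF f = (- sradius (c v)) *\<^sub>R n"
        if "v \<in> face_vertices f" "v \<in> white" for v
      proof -
        have "v = first_white f \<or> v = second_white f" using that face_whites[of f] by auto
        then have "center (c v) + sradius (c v) *\<^sub>R n = hF f"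
          using N(2,4,5) by (auto simp: n_def)
        then show ?thesis by (simp add: algebra_simps)
      qed
      have "w = first_white f \<or> w = second_white f" using f face_whites[of f] by auto
      then show "hF f \<in> points (c w)"
        using touch_point_mem_points[OF touch[of f]] by (auto simp: hF_def)
      show "lor (hF f - M) (hF f - M) = 0" "lor (center (c w) - hF f) (hF f - M) = 0"
        using d(1) by (simp_all add: t cn[OF f(2,3)] null_frame_def lor_minus_left lor_minus_right
          lor_scaleR_left lor_scaleR_right)
      \<comment> \<open>The contact point is m + r n, where n is a multiple of the difference of two
        centers in E.\<close>
      have "center (c (first_white f)) + (sradius (c (first_white f)) *
          (1 / (sradius (c (second_white f)) - sradius (c (first_white f))))) *\<^sub>R
          (center (c (first_white f)) - center (c (second_white f))) \<in> E"
        using face_white_neighbour[OF f(1) b] wh by (intro spacelike_plane_translate E) auto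
      then show "hF f \<in> E" using N(4) by simp
      show "\<exists>n. \<forall>v\<in>face_vertices f \<inter> white. \<exists>k. k \<noteq> 0 \<and> center (c v) - hF f = k *\<^sub>R n"
        using cn timelike_sradius(1) iso(5) by (intro exI[of _ n] ballI) (metis IntE neg_equal_0_iff_equal)
    qed
    \<comment> \<open>If M were in E, every contact point around b, being at null distance from M,
      would equal M. The white centers of each face would then be collinear with M, and all four
      around b would lie on one line.\<close>
    have ME: "M \<notin> E"
    proof
      assume "M \<in> E"
      then have pM: "hF f = M" if "b \<in> face_vertices f" for f
        using spacelike_plane_null_diff[OF E(1)] face(2,4)[OF that wh(1,2)] by blast
      \<comment> \<open>The direction of the line through M and the center at w, as a set that can
        be compared between faces.\<close>
      define g where "g w = {k *\<^sub>R (center (c w) - M) | k. True}" for w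
      have gsub: "g w \<subseteq> g w'"
        if f: "b \<in> face_vertices f" "w \<in> face_vertices f" "w' \<in> face_vertices f"
          "w \<in> neighbours b" "w' \<in> neighbours b" for f w w'
      proof -
        have "w \<in> white" "w' \<in> white" using neighbour_face(1)[OF b] f by auto
        then obtain n k k' where n: "k' \<noteq> 0" "center (c w) - M = k *\<^sub>R n" "center (c w') - M = k' *\<^sub>R n"
          using face(5)[OF f(1) wh(1,2)] f pM[OF f(1)] by (metis IntI)
        then have "center (c w) - M = (k / k') *\<^sub>R (center (c w') - M)" by simp
        then show ?thesis unfolding g_def by (auto simp del: scaleR_right_diff_distrib) 
      qed
      have geq: "g w = g w'" if "w \<in> neighbours b" "w' \<in> neighbours b" for w w'
        by (rule constant_on_neighbours[where b = b, OF _ that]) (use gsub in blast)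
      define w0 where "w0 = first_white b"
      have w0: "w0 \<in> neighbours b"
        unfolding w0_def using face_white_neighbour[OF face_at_vertex b] wh by blast
      have "\<exists>k. center (c w) - M = k *\<^sub>R (center (c w0) - M)" if "w \<in> neighbours b" for w
      proof -
        have "1 *\<^sub>R (center (c w) - M) \<in> g w" unfolding g_def by blast
        with geq[OF that w0] show ?thesis by (auto simp: g_def)
      qed
      then obtain k where k: "\<And>w. w \<in> neighbours b \<Longrightarrow> center (c w) - M = k w *\<^sub>R (center (c w0) - M)"
        by metis
      have "center (c w) - center (c w') = (k w - k w') *\<^sub>R (center (c w0) - M)"
        if "w \<in> neighbours b" "w' \<in> neighbours b" for w w'
        using k[OF that(1)] k[OF that(2)] unfolding scaleR_left_diff_distrib by (metis diff_diff_eq2 diff_add_cancel)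
      then have "collinear ((\<lambda>w. center (c w)) ` neighbours b)"
        unfolding collinear_def by blast
      with assms(3) b show False by (simp add: noncollinear_centers_def)
    qed
    obtain q where q: "q \<in> E" "\<forall>x\<in>E. \<forall>y\<in>E. lor (x - y) (M - q) = 0"
      using spacelike_plane_projection[OF E(1)] by blast
    \<comment> \<open>By Pythagoras the points of E on the null-sphere about M have this squared
      distance from the foot q of M.\<close>
    define R where "R = - lor (M - q) (M - q)"
    define C where "C = {x \<in> E. lor (x - q) (x - q) = R}"
    have p: "hF b \<in> E" "lor (hF b - M) (hF b - M) = 0"
      using face(2,4)[OF face_at_vertex wh(1,2)] by auto
    have R: "R = lor (hF b - q) (hF b - q)"
      using sphere_section[OF q p(1)] p(2) by (simp add: R_def)
    \<comment> \<open>Otherwise M - q would be a null vector orthogonal to a spacelike plane, hence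
      0, and M would lie in E.\<close>
    have "R \<noteq> 0"
    proof
      assume "R = 0"
      then have "M - q = 0"
        using orthogonal_spacelike_plane_null_imp_zero[OF E(1) q(2)] by (simp add: R_def)
      with ME q(1) show False by simp
    qed
    then have "hF b \<noteq> q" using R by (auto simp: lor_simps)
    then have "R > 0" using E(1) p(1) q(1) unfolding R by (auto simp: spacelike_plane_def)
    then have C: "proper_circle C E q R" using E(1) q(1) by (simp add: proper_circle_def C_def)
    show ?thesis
    proof (intro exI[of _ C] conjI allI impI)
      have "hF b \<in> C" using p(1) R by (simp add: C_def)
      then show "spacelike_circle C" by (rule proper_circle_spacelike_circle[OF C])
      fix f w assume f: "b \<in> face_vertices f" "w \<in> face_vertices f" "w \<in> white"
      note F = face[OF f]
      have m: "center (c w) \<in> E" using E(2) face_white_neighbour[OF f(1) b f(2,3)] .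
      have "hF f \<in> C" using F(2,4) sphere_section[OF q F(4)] by (simp add: C_def R_def)
      moreover have "lor (center (c w) - hF f) (M - q) = 0" using q(2) m F(4) by blast
      then have "lor (center (c w) - hF f) (hF f - q) = 0"
        using F(3) by (simp add: lor_diff_left lor_diff_right)
      ultimately show "meets_orthogonally C (c w) (hF f)"
        using meets_orthogonally_proper_circle[OF C iso(5)[OF f(3)]] F(1) m by blast
    qed
  qed
  then obtain hb where hb: "\<And>b. b \<in> black \<Longrightarrow> spacelike_circle (hb b) \<and> (\<forall>f w. b \<in> face_vertices f \<longrightarrow>
      w \<in> face_vertices f \<longrightarrow> w \<in> white \<longrightarrow> meets_orthogonally (hb b) (c w) (hF f))"
    by metis
  have "S_isothermic_net (restrict c white) (restrict hb black) hF"
    unfolding S_isothermic_net_def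
  proof (intro conjI allI ballI impI)
    fix f w w' assume w: "w \<in> face_vertices f \<inter> white" "w' \<in> face_vertices f \<inter> white" "w \<noteq> w'"
    then have "touching (c w) (c w')"
      using touch[of f] touching_commute unfolding face_whites by auto
    then show "oriented_contact (restrict c white w) (restrict c white w')"
      using w by (simp add: touching_oriented_contact)
  qed (use hb iso(5) in auto)
  then show ?thesis by blast
qed

lemma distinct_spheres_cong:
  assumes "\<And>w. w \<in> white \<Longrightarrow> c w = c' w" shows "distinct_spheres c \<longleftrightarrow> distinct_spheres c'"
  unfolding distinct_spheres_def using assms by (intro all_cong1 inj_on_cong) auto

lemma noncollinear_centers_cong:
  assumes "\<And>w. w \<in> white \<Longrightarrow> c w = c' w" shows "noncollinear_centers c \<longleftrightarrow> noncollinear_centers c'"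
proof -
  have "(\<lambda>w. center (c w)) ` neighbours b = (\<lambda>w. center (c' w)) ` neighbours b" if "b \<in> black" for b
    using assms neighbour_face(1)[OF that] by (intro image_cong) auto
  then show ?thesis by (simp add: noncollinear_centers_def)
qed

lemma unique_S_net:
  assumes "isothermic_congruence c cF" "distinct_spheres c" "noncollinear_centers c"
  shows "\<exists>!(hw, hb, hF). S_isothermic_net hw hb hF \<and> (\<forall>w\<in>white. hw w = c w)"
proof -
  define hw where "hw = restrict c white"
  obtain hb hF where net: "S_isothermic_net hw hb hF"
    using S_net_restrict[OF assms] by (auto simp: hw_def)
  have eq: "hw w = c w" if "w \<in> white" for w using that by (simp add: hw_def)
  have d: "distinct_spheres hw" "noncollinear_centers hw"
    using distinct_spheres_cong[of hw c] noncollinear_centers_cong[of hw c] eq assms by auto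
  show ?thesis
  proof (rule ex1I[of _ "(hw, hb, hF)"])
    show "case (hw, hb, hF) of (hw, hb, hF) \<Rightarrow> S_isothermic_net hw hb hF \<and> (\<forall>w\<in>white. hw w = c w)"
      using net eq by simp
  next
    fix x :: "(vertex \<Rightarrow> osphere) \<times> (vertex \<Rightarrow> point set) \<times> (face \<Rightarrow> point)"
    obtain hw' hb' hF' where x: "x = (hw', hb', hF')" by (cases x)
    assume "case x of (hw, hb, hF) \<Rightarrow> S_isothermic_net hw hb hF \<and> (\<forall>w\<in>white. hw w = c w)"
    then have *: "S_isothermic_net hw' hb' hF'" "\<forall>w\<in>white. hw' w = c w" by (auto simp: x)
    then have "hw' \<in> extensional white" by (simp add: S_isothermic_net_def)
    then have hw: "hw' = hw" using *(2) eq net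
      by (intro extensionalityI[of hw' white hw]) (auto simp: S_isothermic_net_def)
    with S_net_unique[of hw hb hF hb' hF'] net *(1) d
    show "x = (hw, hb, hF)" by (auto simp: S_net_def x)
  qed
qed

section \<open>The two isothermic congruences of an S-isothermic net\<close>

text \<open>Adjacent faces use lines of different rulings of their common white sphere.\<close>

definition ruling :: "real \<Rightarrow> face \<Rightarrow> real" where
  "ruling \<epsilon> = (\<lambda>(i, j). if even (i + j) then \<epsilon> else - \<epsilon>)"

lemma ruling_neighbour: "f' \<in> neighbours f \<Longrightarrow> ruling \<epsilon> f' = - ruling \<epsilon> f"
  by (cases f) (auto simp: neighbours_def ruling_def)

lemma ruling_sign: "\<epsilon> \<in> {1, -1} \<Longrightarrow> ruling \<epsilon> f \<in> {1, -1}"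
  by (cases f) (auto simp: ruling_def)

text \<open>The case of two lines of one ruling through the same point of a sphere: each eigenspace
  is a line.\<close>

lemma eigen_parallel:
  assumes "lcross n d = \<sigma> *\<^sub>R d" "lcross n e = \<sigma> *\<^sub>R e" "\<sigma> \<noteq> 0" "d \<noteq> 0"
  shows "\<exists>k. e = k *\<^sub>R d"
  using same_ruling_parallel[OF assms(1,2,3,4), of 1 0 0] by simp

section \<open>Lines of adjacent faces and the centers of the null-spheres\<close>

locale S_net_distinct = S_net +
  assumes distinct_points: "distinct_contact_points hF"
begin

lemma null_diff_imp_eq:
  assumes "b \<in> face_vertices f" "b \<in> face_vertices f'" "b \<in> black"
    "lor (hF f - hF f') (hF f - hF f') = 0"
  shows "hF f = hF f'"
proof -
  obtain E q R where C: "proper_circle (hb b) E q R" using black_circle[OF assms(3)] by blast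
  have "first_white f \<in> face_vertices f" "first_white f \<in> white"
    "first_white f' \<in> face_vertices f'" "first_white f' \<in> white"
    using face_whites[of f] face_whites[of f'] by auto
  then have "hF f \<in> hb b" "hF f' \<in> hb b" using proper_circle_meets(1)[OF C] assms by blast+
  with C assms(4) show ?thesis using spacelike_plane_null_diff by (auto simp: proper_circle_def)
qed

lemma neighbour_points_neq: "f' \<in> neighbours f \<Longrightarrow> hF f \<noteq> hF f'"
  using distinct_points unfolding distinct_contact_points_def by blast

text \<open>Adjacent faces share a black vertex, so both contact points lie on one circle, in a
  spacelike plane.\<close>

lemma neighbour_null_diff:
  assumes "f' \<in> neighbours f" shows "lor (hF f - hF f') (hF f - hF f') \<noteq> 0"
  using neighbour_faces_share[OF assms] null_diff_imp_eq neighbour_points_neq[OF assms] by metis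

text \<open>Meeting lines of one ruling of the common white sphere coincide, and then the two
  contact points would be joined by a null vector.\<close>

lemma neighbour_rulings:
  assumes "f' \<in> neighbours f" "lcross (fnormal f) d = \<sigma> *\<^sub>R d" "lcross (fnormal f') d' = \<sigma> *\<^sub>R d'"
    "\<sigma> \<noteq> 0" "hF f + t *\<^sub>R d = hF f' + t' *\<^sub>R d'"
  shows False
proof -
  obtain w where w: "w \<in> white" "w \<in> face_vertices f" "w \<in> face_vertices f'"
    using neighbour_faces_share[OF assms(1)] by blast
  define r where "r = sradius (hw w)"
  have r: "r \<noteq> 0" using timelike_sradius(1)[OF white_timelike[OF w(1)]] by (simp add: r_def)
  have p: "hF f = center (hw w) + r *\<^sub>R fnormal f" "hF f' = center (hw w) + r *\<^sub>R fnormal f'"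
    using fnormal w by (auto simp: r_def)
  have null: "lor d d = 0" "lor d' d' = 0" using lcross_eigen_null(1) assms(2-4) by blast+
  have "\<exists>a e. lor e e = 0 \<and> hF f - hF f' = a *\<^sub>R e"
  proof (cases "d = 0")
    case True
    then have "hF f - hF f' = t' *\<^sub>R d'" using assms(5) by simp
    then show ?thesis using null by blast
  next
    case False
    have "r *\<^sub>R fnormal f + t *\<^sub>R d = r *\<^sub>R fnormal f' + t' *\<^sub>R d'"
      using assms(5) unfolding p by (simp add: add.assoc)
    then obtain k where "d' = k *\<^sub>R d" using same_ruling_parallel[OF assms(2-4) False r] by blast
    then have "hF f - hF f' = (t' * k - t) *\<^sub>R d" using assms(5) by (simp add: algebra_simps)
    then show ?thesis using null by blast
  qed
  then show False using neighbour_null_diff[OF assms(1)]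
    by (auto simp: lor_scaleR_left lor_scaleR_right)
qed

text \<open>Two common points would make the directions parallel and the contact points differ by a
  null vector. It follows that the lines of a congruence determine the centers of its
  null-spheres.\<close>

lemma neighbour_lines_meet_once:
  assumes "f' \<in> neighbours f" "lor d d = 0"
    "M = hF f + t *\<^sub>R d" "M = hF f' + t' *\<^sub>R d'" "M' = hF f + u *\<^sub>R d" "M' = hF f' + u' *\<^sub>R d'"
  shows "M = M'"
proof (rule ccontr)
  assume "M \<noteq> M'"
  then have "t' - u' \<noteq> 0" using assms(4,6) by auto
  have "M - M' = (t - u) *\<^sub>R d" unfolding assms(3,5) by (simp add: algebra_simps)
  moreover have "M - M' = (t' - u') *\<^sub>R d'" unfolding assms(4,6) by (simp add: algebra_simps)
  ultimately have "(t' - u') *\<^sub>R d' = (t - u) *\<^sub>R d" by simp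
  then have "(1 / (t' - u')) *\<^sub>R (t' - u') *\<^sub>R d' = (1 / (t' - u')) *\<^sub>R (t - u) *\<^sub>R d" by metis
  then have "d' = ((t - u) / (t' - u')) *\<^sub>R d" using \<open>t' - u' \<noteq> 0\<close> by simp
  then obtain k where "d' = k *\<^sub>R d" by blast
  then have "hF f - hF f' = (t' * k - t) *\<^sub>R d" using assms(3,4) by (simp add: algebra_simps)
  then show False using neighbour_null_diff[OF assms(1)] assms(2)
    by (simp add: lor_scaleR_left lor_scaleR_right)
qed

text \<open>M is the center of one of the two null-spheres through the circle at b: it lies on the
  axis of the circle, and the sign chooses the side.\<close>

lemma apex_exists:
  assumes b: "b \<in> black" and \<epsilon>: "\<epsilon> \<in> {1, -1}"
  shows "\<exists>M. \<forall>f. b \<in> face_vertices f \<longrightarrow>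
    lcross (fnormal f) (M - hF f) = ruling \<epsilon> f *\<^sub>R (M - hF f)"
proof -
  obtain E q R where C: "proper_circle (hb b) E q R" using black_circle[OF b] by blast
  have E: "spacelike_plane E" "q \<in> E" "R > 0" using C by (auto simp: proper_circle_def)
  have w: "first_white f \<in> face_vertices f" "first_white f \<in> white" for f
    using face_whites[of f] by auto
  have p: "hF f \<in> E" "lor (hF f - q) (hF f - q) = R" "hF f \<in> hb b"
    if "b \<in> face_vertices f" for f
    using proper_circle_meets(1)[OF C that b w] C by (auto simp: proper_circle_def)
  define n0 \<sigma> y where "n0 = fnormal b" and "\<sigma> = ruling \<epsilon> b" and "y = hF b - q"
  have \<sigma>: "\<sigma> * \<sigma> = 1" using ruling_sign[OF \<epsilon>, of b] by (auto simp: \<sigma>_def)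
  have n0: "lor n0 n0 = 1" "lor n0 y = 0" "lor y y = R"
    using fnormal_unit fnormal_orthogonal[OF C face_at_vertex b] p[OF face_at_vertex]
    by (auto simp: n0_def y_def)
  \<comment> \<open>Since y is orthogonal to n0, applying \<open>lcross n0\<close> twice to y
    returns y. Hence M - \<open>hF b\<close> = -(y + \<sigma> \<open>lcross n0 y\<close>) is an
    eigenvector for \<sigma>, by the same device as in \<open>null_dir\<close>, while M - q is
    orthogonal to n0 and y.\<close>
  define M where "M = q - \<sigma> *\<^sub>R lcross n0 y"
  have Mq: "M - q = - (\<sigma> *\<^sub>R lcross n0 y)" by (simp add: M_def)
  have M0: "lcross n0 (M - hF b) = \<sigma> *\<^sub>R (M - hF b)"
  proof -
    have M: "M - hF b = - y - \<sigma> *\<^sub>R lcross n0 y" by (simp add: M_def y_def)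
    have "lcross n0 (- y) = - lcross n0 y" by (simp add: lcross_def vec3_eq_iff)
    moreover have "lcross n0 (lcross n0 y) = y" using n0 by (simp add: lcross_lcross)
    ultimately show ?thesis unfolding M
      by (simp add: lcross_diff_right lcross_scaleR_right scaleR_diff_right \<sigma>)
  qed
  obtain n where n: "lor n (hF b - q) = 0"
    "\<And>x. x \<in> E \<longleftrightarrow> (\<exists>s t. x = hF b + s *\<^sub>R n + t *\<^sub>R (hF b - q))"
    using proper_circle_frame[OF C p(3)[OF face_at_vertex]] by blast
  \<comment> \<open>The white center m lies in E, so n0 is a direction of E, orthogonal to y and
    thus parallel to n. Being orthogonal to n0 and y, M - q is orthogonal to all of E.\<close>
  have orth: "lor (x - x') (M - q) = 0" if xE: "x \<in> E" "x' \<in> E" for x x'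
  proof -
    define m r where "m = center (hw (first_white b))" and "r = sradius (hw (first_white b))"
    have m: "m \<in> E" using proper_circle_meets(3)[OF C face_at_vertex b w] by (simp add: m_def)
    have r: "r \<noteq> 0" using timelike_sradius(1)[OF white_timelike[OF w(2)]] by (simp add: r_def)
    have pm: "hF b = m + r *\<^sub>R n0" using fnormal[OF w] by (simp add: m_def r_def n0_def)
    obtain s t where st: "m = hF b + s *\<^sub>R n + t *\<^sub>R y" using m n(2) unfolding y_def by blast
    have "m + r *\<^sub>R n0 + s *\<^sub>R n + t *\<^sub>R y = m" using st pm by simp
    then have "r *\<^sub>R n0 + (s *\<^sub>R n + t *\<^sub>R y) = 0" by (simp add: add.assoc)
    then have rst: "r *\<^sub>R n0 = - (s *\<^sub>R n + t *\<^sub>R y)" by (simp only: eq_neg_iff_add_eq_0)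
    moreover have "lor (r *\<^sub>R n0) y = 0" using n0 by (simp add: lor_scaleR_left)
    ultimately have "t * R = 0"
      using n(1) n0(3) by (simp add: rst lor_diff_left lor_minus_left lor_scaleR_left flip: y_def)
    then have "t = 0" using E(3) by simp
    then have rs: "r *\<^sub>R n0 = - (s *\<^sub>R n)" using rst by simp
    have "s \<noteq> 0"
    proof
      assume "s = 0"
      with rs r have "n0 = 0" by simp
      with n0(1) show False by (simp add: lor_zero_left)
    qed
    have "s * lor n (lcross n0 y) = - lor (- (s *\<^sub>R n)) (lcross n0 y)"
      by (simp add: lor_minus_left lor_scaleR_left)
    also have "\<dots> = 0" unfolding rs[symmetric] by (simp add: lor_scaleR_left lor_lcross_left)
    finally have nz: "lor n (lcross n0 y) = 0" using \<open>s \<noteq> 0\<close> by simp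
    obtain a c a' c' where x: "x = hF b + a *\<^sub>R n + c *\<^sub>R y" "x' = hF b + a' *\<^sub>R n + c' *\<^sub>R y"
      using xE n(2) unfolding y_def by blast
    have "x - x' = (a - a') *\<^sub>R n + (c - c') *\<^sub>R y" unfolding x by (simp add: algebra_simps)
    then show ?thesis unfolding Mq
      by (simp add: lor_minus_right lor_scaleR_right lor_add_left lor_scaleR_left nz lor_lcross_right)
  qed
  have MM: "lor (M - q) (M - q) = - R"
    unfolding Mq using n0 \<sigma>
    by (simp add: lor_minus_left lor_minus_right lor_scaleR_left lor_scaleR_right lor_lcross_lcross
        flip: mult.assoc)
  have null: "lor (M - hF f) (M - hF f) = 0" "lor (fnormal f) (M - hF f) = 0"
    if f: "b \<in> face_vertices f" for f
  proof -
    have pq: "lor (hF f - q) (M - q) = 0" using orth p(1)[OF f] E(2) by blast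
    have "M - hF f = (M - q) - (hF f - q)" by simp
    then have "lor (M - hF f) (M - hF f)
        = lor (M - q) (M - q) - 2 * lor (hF f - q) (M - q) + lor (hF f - q) (hF f - q)"
      by (simp only: lor_diff_left lor_diff_right) (simp add: lor_commute)
    then show "lor (M - hF f) (M - hF f) = 0" using MM pq p(2)[OF f] by simp
    have m: "center (hw (first_white f)) \<in> E" using proper_circle_meets(3)[OF C f b w] .
    have "sradius (hw (first_white f)) *\<^sub>R fnormal f = hF f - center (hw (first_white f))"
      using fnormal[OF w, of f] by (simp add: algebra_simps)
    then have "sradius (hw (first_white f)) * lor (fnormal f) (M - q) = 0"
      using orth[OF p(1)[OF f] m] by (metis lor_scaleR_left)
    then have "lor (fnormal f) (M - q) = 0"
      using timelike_sradius(1)[OF white_timelike[OF w(2)]] by simp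
    then show "lor (fnormal f) (M - hF f) = 0"
      using fnormal_orthogonal[OF C f b] by (simp add: lor_diff_right)
  qed
  define good where "good f \<longleftrightarrow> lcross (fnormal f) (M - hF f) = ruling \<epsilon> f *\<^sub>R (M - hF f)" for f
  \<comment> \<open>At f' the null vector M - \<open>hF f'\<close> is an eigenvector for 1 or -1.
    The wrong sign would be that of f, giving two lines of one ruling that meet in M.\<close>
  have step: "good f'" if f: "b \<in> face_vertices f" "b \<in> face_vertices f'" "f' \<in> neighbours f" "good f" for f f'
  proof (rule ccontr)
    assume "\<not> good f'"
    moreover have "lcross (fnormal f') (M - hF f') = M - hF f' \<or>
        lcross (fnormal f') (M - hF f') = - (M - hF f')"
      by (rule null_imp_lcross_eigen[OF fnormal_unit null(2,1)[OF f(2)]])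
    ultimately have "lcross (fnormal f') (M - hF f') = ruling \<epsilon> f *\<^sub>R (M - hF f')"
      using ruling_neighbour[OF f(3), of \<epsilon>] ruling_sign[OF \<epsilon>, of f] unfolding good_def by auto
    moreover have "ruling \<epsilon> f \<noteq> 0" using ruling_sign[OF \<epsilon>, of f] by auto
    moreover have "hF f + 1 *\<^sub>R (M - hF f) = hF f' + 1 *\<^sub>R (M - hF f')" by simp
    ultimately show False using neighbour_rulings[OF f(3)] f(4) unfolding good_def by blast
  qed
  obtain i j where ij: "b = (i, j)" by fastforce
  have g0: "good (i, j)" using M0 by (simp add: good_def n0_def \<sigma>_def ij)
  have v: "b \<in> face_vertices (i, j)" "b \<in> face_vertices (i - 1, j)"
    "b \<in> face_vertices (i, j - 1)" "b \<in> face_vertices (i - 1, j - 1)"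
    by (auto simp: ij face_vertices_def)
  have g1: "good (i - 1, j)" by (rule step[OF v(1,2) _ g0]) (simp add: neighbours_def)
  have g2: "good (i, j - 1)" by (rule step[OF v(1,3) _ g0]) (simp add: neighbours_def)
  have g3: "good (i - 1, j - 1)" by (rule step[OF v(2,4) _ g1]) (simp add: neighbours_def)
  have "good f" if "b \<in> face_vertices f" for f
  proof -
    have "f \<in> {(i, j), (i - 1, j), (i, j - 1), (i - 1, j - 1)}"
      using that by (cases f) (auto simp: ij face_vertices_def)
    with g0 g1 g2 g3 show ?thesis by auto
  qed
  then show ?thesis unfolding good_def by blast
qed

text \<open>The property determines the point: it lies on the lines of adjacent faces, which meet
  only once.\<close>

definition apex :: "real \<Rightarrow> vertex \<Rightarrow> point" where
  "apex \<epsilon> b = (SOME M. \<forall>f. b \<in> face_vertices f \<longrightarrow>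
    lcross (fnormal f) (M - hF f) = ruling \<epsilon> f *\<^sub>R (M - hF f))"

definition fdir :: "real \<Rightarrow> face \<Rightarrow> point" where
  "fdir \<sigma> f = null_dir (fnormal f) \<sigma>"

lemma fdir:
  assumes "\<sigma> \<in> {1, -1}"
  shows "fdir \<sigma> f \<noteq> 0" "lcross (fnormal f) (fdir \<sigma> f) = \<sigma> *\<^sub>R fdir \<sigma> f"
    "null_frame (fdir \<sigma> f) (fnormal f)"
proof -
  show *: "fdir \<sigma> f \<noteq> 0" "lcross (fnormal f) (fdir \<sigma> f) = \<sigma> *\<^sub>R fdir \<sigma> f"
    using null_dir_nonzero[OF fnormal_unit[of f]] lcross_null_dir[OF fnormal_unit[of f], of \<sigma>] assms
    by (auto simp: fdir_def)
  have "\<sigma> \<noteq> 0" using assms by auto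
  then show "null_frame (fdir \<sigma> f) (fnormal f)"
    using * lcross_eigen_null[OF *(2)] fnormal_unit by (simp add: null_frame_def)
qed

lemma apex_on_line:
  assumes "b \<in> black" "\<epsilon> \<in> {1, -1}" "b \<in> face_vertices f"
  shows "\<exists>t. apex \<epsilon> b = hF f + t *\<^sub>R fdir (ruling \<epsilon> f) f"
proof -
  have "lcross (fnormal f) (apex \<epsilon> b - hF f) = ruling \<epsilon> f *\<^sub>R (apex \<epsilon> b - hF f)"
    using someI_ex[OF apex_exists[OF assms(1,2)]] assms(3) unfolding apex_def by blast
  moreover have "ruling \<epsilon> f \<noteq> 0" using ruling_sign[OF assms(2), of f] by auto
  ultimately obtain k where "apex \<epsilon> b - hF f = k *\<^sub>R fdir (ruling \<epsilon> f) f"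
    using eigen_parallel[OF fdir(2) _ _ fdir(1)] ruling_sign[OF assms(2)] by blast
  then have "apex \<epsilon> b = hF f + k *\<^sub>R fdir (ruling \<epsilon> f) f" by (simp add: algebra_simps)
  then show ?thesis by blast
qed

section \<open>The two congruences, their difference and their completeness\<close>

definition null_cong :: "real \<Rightarrow> vertex \<Rightarrow> osphere" where
  "null_cong \<epsilon> v = (if v \<in> white then hw v else Null (apex \<epsilon> v))"

definition null_cong_line :: "real \<Rightarrow> face \<Rightarrow> oline" where
  "null_cong_line \<epsilon> f = oline_of (hF f) (fdir (ruling \<epsilon> f) f) (fnormal f)"

lemma isothermic_null_cong:
  assumes \<epsilon>: "\<epsilon> \<in> {1, -1}"
  shows "isothermic_congruence (null_cong \<epsilon>) (null_cong_line \<epsilon>)"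
  unfolding isothermic_congruence_def null_congruence_def contact_congruence_def
proof (intro conjI allI ballI)
  show "null_sphere (null_cong \<epsilon> v) \<or> timelike (null_cong \<epsilon> v)" for v
    using white_timelike by (auto simp: null_cong_def null_sphere_def)
  show "oriented_isotropic_line (null_cong_line \<epsilon> f)" for f
    unfolding oriented_isotropic_line_iff null_cong_line_def using fdir(3)[OF ruling_sign[OF \<epsilon>]] by blast
  show "null_sphere (null_cong \<epsilon> b)" if "b \<in> black" for b
    using that white_iff_not_black by (auto simp: null_cong_def null_sphere_def)
  show "timelike (null_cong \<epsilon> w)" if "w \<in> white" for w using that white_timelike by (simp add: null_cong_def)
  show "contact_line (null_cong \<epsilon> v) (null_cong_line \<epsilon> f)" if "v \<in> face_vertices f" for f v
  proof (cases "v \<in> white")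
    case True
    have "center (hw v) = hF f + 0 *\<^sub>R fdir (ruling \<epsilon> f) f - sradius (hw v) *\<^sub>R fnormal f"
      using fnormal[OF that True] by simp
    then show ?thesis
      using contact_line_timelike[OF white_timelike[OF True] fdir(3)[OF ruling_sign[OF \<epsilon>]]] True
      unfolding null_cong_def null_cong_line_def by auto
  next
    case False
    then have "v \<in> black" using white_iff_not_black by blast
    with apex_on_line[OF this \<epsilon> that] False show ?thesis
      unfolding null_cong_def null_cong_line_def by (simp add: contact_line_Null del: contact_line.simps)
  qed
  show "\<exists>E. spacelike_plane E \<and> (\<forall>w\<in>neighbours b. center (null_cong \<epsilon> w) \<in> E)" if b: "b \<in> black" for b
  proof -
    obtain E q R where C: "proper_circle (hb b) E q R" using black_circle[OF b] by blast
    have "center (null_cong \<epsilon> w) \<in> E" if w: "w \<in> neighbours b" for w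
    proof -
      obtain f where "b \<in> face_vertices f" "w \<in> face_vertices f" "w \<in> white"
        using neighbour_face[OF b w] by blast
      then show ?thesis using proper_circle_meets(3)[OF C _ b] by (simp add: null_cong_def)
    qed
    then show ?thesis using C by (auto simp: proper_circle_def)
  qed
qed

text \<open>A common line at the face (0, 0) would have a direction that is an eigenvector for both
  1 and -1, hence 0.\<close>

lemma null_cong_line_inj: "null_cong_line 1 \<noteq> null_cong_line (- 1)"
proof
  assume "null_cong_line 1 = null_cong_line (- 1)"
  then have "fst (null_cong_line 1 (0, 0)) = fst (null_cong_line (- 1) (0, 0))" by simp
  then have L: "{hF (0, 0) + t *\<^sub>R fdir 1 (0, 0) | t. True} = {hF (0, 0) + t *\<^sub>R fdir (- 1) (0, 0) | t. True}"
    by (simp add: null_cong_line_def oline_of_def ruling_def)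
  have "hF (0, 0) + 1 *\<^sub>R fdir 1 (0, 0) \<in> {hF (0, 0) + t *\<^sub>R fdir 1 (0, 0) | t. True}" by blast
  then obtain t where t: "fdir 1 (0, 0) = t *\<^sub>R fdir (- 1) (0, 0)" unfolding L by auto
  have "fdir 1 (0, 0) = lcross (fnormal (0, 0)) (t *\<^sub>R fdir (- 1) (0, 0))"
    using fdir(2)[of 1 "(0, 0)"] t by simp
  also have "\<dots> = - fdir 1 (0, 0)" using fdir(2)[of "- 1" "(0, 0)"] by (simp add: lcross_scaleR_right t)
  finally have "2 *\<^sub>R fdir 1 (0, 0) = 0" by (simp add: scaleR_2 eq_neg_iff_add_eq_0)
  then show False using fdir(1)[of 1] by simp
qed

lemma isothermic_null_cong_complete:
  assumes "isothermic_congruence c cF" "\<forall>w\<in>white. c w = hw w"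
  shows "\<exists>\<epsilon>\<in>{1, -1}. c = null_cong \<epsilon> \<and> cF = null_cong_line \<epsilon>"
proof -
  have iso: "\<And>f. oriented_isotropic_line (cF f)"
    "\<And>f v. v \<in> face_vertices f \<Longrightarrow> contact_line (c v) (cF f)"
    "\<And>b. b \<in> black \<Longrightarrow> null_sphere (c b)"
    using assms(1)
    by (auto simp: isothermic_congruence_def null_congruence_def contact_congruence_def)
  have "\<exists>\<sigma>\<in>{1, -1}. cF f = oline_of (hF f) (fdir \<sigma> f) (fnormal f)" for f
  proof -
    have wh: "first_white f \<in> face_vertices f" "first_white f \<in> white"
      "second_white f \<in> face_vertices f" "second_white f \<in> white"
      using face_whites[of f] by auto
    have "contact_line (hw (first_white f)) (cF f)" "contact_line (hw (second_white f)) (cF f)"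
      using iso(2)[OF wh(1)] iso(2)[OF wh(3)] assms(2) wh by auto
    then obtain d where d: "null_frame d (fnormal f)" "cF f = oline_of (hF f) d (fnormal f)"
      using contact_line_touching[OF iso(1) face_touching] unfolding fnormal_def contact_point by blast
    have "lcross (fnormal f) d = d \<or> lcross (fnormal f) d = - d"
      using d(1) by (intro null_imp_lcross_eigen) (auto simp: null_frame_def)
    then obtain \<sigma> :: real where \<sigma>: "\<sigma> \<in> {1, -1}" "lcross (fnormal f) d = \<sigma> *\<^sub>R d" by force
    have "\<sigma> \<noteq> 0" "d \<noteq> 0" using \<sigma> d by (auto simp: null_frame_def)
    \<comment> \<open>The unknown direction d is identified with the standard one up to a nonzero
      factor, which does not change the oriented line.\<close>
    then obtain k where k: "fdir \<sigma> f = k *\<^sub>R d" using eigen_parallel[OF \<sigma>(2) fdir(2)[OF \<sigma>(1)]] by blast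
    then have "k \<noteq> 0" using fdir(1)[OF \<sigma>(1), of f] by auto
    then show ?thesis using d(2) \<sigma>(1) oline_of_scale k by metis
  qed
  then obtain \<sigma> where \<sigma>: "\<And>f. \<sigma> f \<in> {1, -1}" "\<And>f. cF f = oline_of (hF f) (fdir (\<sigma> f) f) (fnormal f)"
    by metis
  have on_line: "\<exists>t. center (c b) = hF f + t *\<^sub>R fdir (\<sigma> f) f" if bf: "b \<in> black" "b \<in> face_vertices f" for b f
  proof -
    obtain M where M: "c b = Null M" using iso(3)[OF bf(1)] by (auto simp: null_sphere_def)
    then have "contact_line (Null M) (oline_of (hF f) (fdir (\<sigma> f) f) (fnormal f))"
      using iso(2)[OF bf(2)] \<sigma>(2) by metis
    then show ?thesis using M contact_line_Null by simp
  qed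
  \<comment> \<open>The lines of f and f' both pass through the center of the null-sphere at a
    common black vertex, so they cannot belong to one ruling.\<close>
  have flip: "\<sigma> f' = - \<sigma> f" if f: "f' \<in> neighbours f" for f f'
  proof (rule ccontr)
    assume "\<sigma> f' \<noteq> - \<sigma> f"
    then have eq: "\<sigma> f' = \<sigma> f" using \<sigma>(1)[of f] \<sigma>(1)[of f'] by auto
    obtain b where b: "b \<in> black" "b \<in> face_vertices f" "b \<in> face_vertices f'"
      using neighbour_faces_share[OF f] by blast
    obtain t t' where "center (c b) = hF f + t *\<^sub>R fdir (\<sigma> f) f"
      "center (c b) = hF f' + t' *\<^sub>R fdir (\<sigma> f) f'"
      using on_line[OF b(1,2)] on_line[OF b(1,3)] eq by auto
    then have "hF f + t *\<^sub>R fdir (\<sigma> f) f = hF f' + t' *\<^sub>R fdir (\<sigma> f) f'" by simp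
    moreover have "\<sigma> f \<noteq> 0" using \<sigma>(1)[of f] by auto
    ultimately show False
      using neighbour_rulings[OF f fdir(2)[OF \<sigma>(1)[of f]] fdir(2)[OF \<sigma>(1)[of f]]] by blast
  qed
  define \<epsilon> where "\<epsilon> = \<sigma> (0, 0)"
  have \<epsilon>: "\<epsilon> \<in> {1, -1}" using \<sigma>(1) by (simp add: \<epsilon>_def)
  have \<sigma>_eq: "\<sigma> f = ruling \<epsilon> f" for f
  proof -
    \<comment> \<open>Both factors change sign between adjacent faces, so the product is the same at
      all faces.\<close>
    have "\<sigma> f * ruling 1 f = \<sigma> (0, 0) * ruling 1 (0, 0)"
      by (rule neighbours_connected) (simp add: flip ruling_neighbour)
    then show ?thesis by (cases f) (auto simp: ruling_def \<epsilon>_def split: if_splits)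
  qed
  have "cF = null_cong_line \<epsilon>" using \<sigma>(2) \<sigma>_eq by (auto simp: null_cong_line_def)
  moreover have "c v = null_cong \<epsilon> v" for v
  proof (cases "v \<in> white")
    case True
    then show ?thesis using assms(2) by (simp add: null_cong_def)
  next
    case False
    then have b: "v \<in> black" using white_iff_not_black by blast
    \<comment> \<open>Two adjacent faces at v suffice: their lines contain both centers and meet
      only once.\<close>
    obtain i j where v: "v = (i, j)" by fastforce
    have f: "v \<in> face_vertices (i, j)" "v \<in> face_vertices (i - 1, j)" "(i - 1, j) \<in> neighbours (i, j)"
      by (auto simp: v face_vertices_def neighbours_def)
    have "lor (fdir (ruling \<epsilon> (i, j)) (i, j)) (fdir (ruling \<epsilon> (i, j)) (i, j)) = 0"
      using fdir(3)[OF ruling_sign[OF \<epsilon>]] by (simp add: null_frame_def)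
    then have "center (c v) = apex \<epsilon> v"
      using on_line[OF b f(1)] on_line[OF b f(2)] apex_on_line[OF b \<epsilon> f(1)] apex_on_line[OF b \<epsilon> f(2)]
        neighbour_lines_meet_once[OF f(3)] unfolding \<sigma>_eq by blast
    then show ?thesis using iso(3)[OF b] False by (auto simp: null_sphere_def null_cong_def)
  qed
  ultimately show ?thesis using \<epsilon> by blast
qed

lemma card_isothermic_congruences:
  "card {(c, cF). isothermic_congruence c cF \<and> (\<forall>w\<in>white. c w = hw w)} = 2"
proof -
  have "{(c, cF). isothermic_congruence c cF \<and> (\<forall>w\<in>white. c w = hw w)}
      = {(null_cong 1, null_cong_line 1), (null_cong (- 1), null_cong_line (- 1))}"
  proof (intro equalityI subsetI)
    fix x assume "x \<in> {(c, cF). isothermic_congruence c cF \<and> (\<forall>w\<in>white. c w = hw w)}"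
    then show "x \<in> {(null_cong 1, null_cong_line 1), (null_cong (- 1), null_cong_line (- 1))}"
      using isothermic_null_cong_complete by (cases x) force
  next
    have "null_cong \<epsilon> w = hw w" if "w \<in> white" for \<epsilon> w using that by (simp add: null_cong_def)
    then show "x \<in> {(c, cF). isothermic_congruence c cF \<and> (\<forall>w\<in>white. c w = hw w)}"
      if "x \<in> {(null_cong 1, null_cong_line 1), (null_cong (- 1), null_cong_line (- 1))}" for x
      using that isothermic_null_cong[of 1] isothermic_null_cong[of "- 1"] by auto
  qed
  then show ?thesis using null_cong_line_inj by simp
qed

end

theorem theorem2p12:
  shows
    "(\<forall>c cF. isothermic_congruence c cF \<and> distinct_spheres c \<and> noncollinear_centers c \<longrightarrow>
        (\<exists>!(hw, hb, hF). S_isothermic_net hw hb hF \<and> (\<forall>w\<in>white. hw w = c w))) \<and>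
     (\<forall>hw hb hF. S_isothermic_net hw hb hF \<and> distinct_spheres hw \<and> distinct_contact_points hF \<longrightarrow>
        card {(c, cF). isothermic_congruence c cF \<and> (\<forall>w\<in>white. c w = hw w)} = 2)"
proof (intro conjI allI impI; elim conjE)
  show "\<exists>!(hw, hb, hF). S_isothermic_net hw hb hF \<and> (\<forall>w\<in>white. hw w = c w)"
    if "isothermic_congruence c cF" "distinct_spheres c" "noncollinear_centers c" for c cF
    using that by (rule unique_S_net)
next
  fix hw hb hF
  assume "S_isothermic_net hw hb hF" "distinct_spheres hw" "distinct_contact_points hF"
  then interpret S_net_distinct hw hb hF by unfold_locales
  show "card {(c, cF). isothermic_congruence c cF \<and> (\<forall>w\<in>white. c w = hw w)} = 2"
    by (rule card_isothermic_congruences)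
qed

end
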